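(* Let $(X,d,m)$ be a metric space with random walk. Suppose that the Ricci curvature is at least $\kappa>0$. Let $0<\lambda\leq\frac{1}{24\sigma_\infty(1+U)}$ and consider the $\lambda$-range gradient $Df$. Then for any function $f:X\to\mathbb{R}$ such that $Df<\infty$, one has $$\mathrm{Var}_\nu f\leq\left(\sup_x\frac{4\sigma(x)^2}{\kappa n_x}\right)\int(Df)^2\,\mathrm{d}\nu$$ and for positive $f$, $$\mathrm{Ent}_\nu f\leq\left(\sup_x\frac{4\sigma(x)^2}{\kappa n_x}\right)\int\frac{(Df)^2}{f}\,\mathrm{d}\nu$$ where $\nu$ is the invariant distribution. If moreover the random walk is reversible with respect to $\nu$, then $$\mathrm{Var}_\nu f\leq\int V(x)\,Df(x)^2\,\mathrm{d}\nu(x)$$ and (for positive $f$) $$\mathrm{Ent}_\nu f\leq\int V(x)\,\frac{Df(x)^2}{f(x)}\,\mathrm{d}\nu(x)$$ where $$V(x)=2\sum_{t=0}^\infty(1-\kappa/2)^{2t}\,M^{t+1}\!\left(\frac{\sigma(x)^2}{n_x}\right).$$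
   Context: $(X,d)$ is a Polish metric space with its Borel $\sigma$-algebra. A random walk $m$ on $X$ is a family of probability measures $(m_x)_{x\in X}$ on $X$, depending measurably on $x$, each having finite first moment. The $L^1$ transportation distance is $\mathcal{T}_1(\nu_1,\nu_2):=\inf_{\xi}\int d\,\mathrm{d}\xi$, over all measures $\xi$ on $X\times X$ with marginals $\nu_1,\nu_2$. For distinct $x,y$, $\kappa(x,y):=1-\frac{\mathcal{T}_1(m_x,m_y)}{d(x,y)}$; "Ricci curvature at least $\kappa$" means $\kappa(x,y)\geq\kappa$ for all distinct $x,y$. When $\kappa>0$ there is a unique probability measure $\nu$ with finite first moment that is invariant, i.e. $\nu=\int\mathrm{d}\nu(x)\,m_x$; the walk is reversible w.r.t. $\nu$ if $\mathrm{d}\nu(x)\,\mathrm{d}m_x(y)=\mathrm{d}\nu(y)\,\mathrm{d}m_y(x)$. The averaging operator is $Mf(x):=\int f(y)\,\mathrm{d}m_x(y)$; $M^{t+1}(\sigma(x)^2/n_x)$ denotes $M^{t+1}$ applied to the function $x\mapsto\sigma(x)^2/n_x$, evaluated at $x$. Spread: $\sigma(x):=\left(\frac12\iint d(y,z)^2\,\mathrm{d}m_x(y)\,\mathrm{d}m_x(z)\right)^{1/2}$. Local dimension: $n_x:=\frac{\sigma(x)^2}{\sup\{\mathrm{Var}_{m_x}f,\ f\ 1\text{-Lipschitz}\}}$, so that $\sigma(x)^2/n_x=\sup\{\mathrm{Var}_{m_x}f,\ f\ 1\text{-Lipschitz}\}$. Also $\sigma_\infty:=\sup_x\frac12\,\mathrm{diam}\,\mathrm{Supp}\,m_x$.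 Unstability: for each pair of distinct points $x,y$ choose a coupling $\xi_{xy}$ of $m_x$ and $m_y$ realizing $\mathcal{T}_1(m_x,m_y)$ and set $\kappa_\pm(x,y):=\frac{1}{d(x,y)}\int(d(x,y)-d(x',y'))_\pm\,\mathrm{d}\xi_{xy}(x',y')$, where $a_+$ and $a_-$ are the positive and negative parts of $a\in\mathbb{R}$, so that $\kappa(x,y)=\kappa_+(x,y)-\kappa_-(x,y)$. Set $U(x,y):=\kappa_-(x,y)/\kappa(x,y)$ and $U:=\sup_{x\neq y}U(x,y)$. $\lambda$-range gradient: for $\lambda>0$ and $f:X\to\mathbb{R}$, $$(Df)(x):=\sup_{y,y'\in X,\,y\neq y'}\frac{|f(y)-f(y')|}{d(y,y')}\,e^{-\lambda d(x,y)-\lambda d(x,y')}.$$ Entropy: $\mathrm{Ent}_\nu f:=\int f\log f\,\mathrm{d}\nu-\left(\int f\,\mathrm{d}\nu\right)\log\int f\,\mathrm{d}\nu$. *)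

theory Defs
  imports "HOL-Probability.Probability"
begin

(* Quantities that may a priori be infinite take values in ennreal, where 0 / 0 = 0 * top = 0,
   1 / 0 = top and 1 / top = 0. *)

definition finite_first_moment :: "'a::metric_space measure \<Rightarrow> bool" where
  "finite_first_moment \<mu> \<longleftrightarrow> (\<exists>o'. (\<integral>\<^sup>+ y. ennreal (dist o' y) \<partial>\<mu>) < \<infinity>)"

(* Measurability into prob_algebra says that each m x is a Borel probability measure and that
   x maps measurably to m x A for every Borel set A. *)
definition random_walk :: "('a::polish_space \<Rightarrow> 'a measure) \<Rightarrow> bool" where
  "random_walk m \<longleftrightarrow> m \<in> borel \<rightarrow>\<^sub>M prob_algebra borel \<and> (\<forall>x. finite_first_moment (m x))"

definition coupling ::
  "'a::polish_space measure \<Rightarrow> 'a measure \<Rightarrow> ('a \<times> 'a) measure \<Rightarrow> bool" where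
  "coupling \<mu>\<^sub>1 \<mu>\<^sub>2 \<xi> \<longleftrightarrow>
     sets \<xi> = sets borel \<and> distr \<xi> borel fst = \<mu>\<^sub>1 \<and> distr \<xi> borel snd = \<mu>\<^sub>2"

definition transport_dist :: "'a::polish_space measure \<Rightarrow> 'a measure \<Rightarrow> ennreal" where
  "transport_dist \<mu>\<^sub>1 \<mu>\<^sub>2 = (INF \<xi>\<in>{\<xi>. coupling \<mu>\<^sub>1 \<mu>\<^sub>2 \<xi>}. \<integral>\<^sup>+ (x, y). ennreal (dist x y) \<partial>\<xi>)"

definition optimal_coupling ::
  "'a::polish_space measure \<Rightarrow> 'a measure \<Rightarrow> ('a \<times> 'a) measure \<Rightarrow> bool" where
  "optimal_coupling \<mu>\<^sub>1 \<mu>\<^sub>2 \<xi> \<longleftrightarrow>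
     coupling \<mu>\<^sub>1 \<mu>\<^sub>2 \<xi> \<and> (\<integral>\<^sup>+ (x, y). ennreal (dist x y) \<partial>\<xi>) = transport_dist \<mu>\<^sub>1 \<mu>\<^sub>2"

(* For a random walk the transportation distance is finite, by the first moment condition,
   so enn2real loses nothing. *)
definition curvature :: "('a::polish_space \<Rightarrow> 'a measure) \<Rightarrow> 'a \<Rightarrow> 'a \<Rightarrow> real" where
  "curvature m x y = 1 - enn2real (transport_dist (m x) (m y)) / dist x y"

definition curvature_ge :: "('a::polish_space \<Rightarrow> 'a measure) \<Rightarrow> real \<Rightarrow> bool" where
  "curvature_ge m \<kappa> \<longleftrightarrow> (\<forall>x y. x \<noteq> y \<longrightarrow> \<kappa> \<le> curvature m x y)"

definition invariant_distribution ::
  "('a::polish_space \<Rightarrow> 'a measure) \<Rightarrow> 'a measure \<Rightarrow> bool" where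
  "invariant_distribution m \<nu> \<longleftrightarrow>
     prob_space \<nu> \<and> sets \<nu> = sets borel \<and> finite_first_moment \<nu> \<and> \<nu> = \<nu> \<bind> m"

(* The measure d\<nu>(x) dm_x(y) on pairs (x, y). *)
definition step_measure ::
  "('a::polish_space \<Rightarrow> 'a measure) \<Rightarrow> 'a measure \<Rightarrow> ('a \<times> 'a) measure" where
  "step_measure m \<nu> = \<nu> \<bind> (\<lambda>x. distr (m x) borel (\<lambda>y. (x, y)))"

definition reversible :: "('a::polish_space \<Rightarrow> 'a measure) \<Rightarrow> 'a measure \<Rightarrow> bool" where
  "reversible m \<nu> \<longleftrightarrow> step_measure m \<nu> = distr (step_measure m \<nu>) borel (\<lambda>(x, y). (y, x))"

definition averaging ::
  "('a::polish_space \<Rightarrow> 'a measure) \<Rightarrow> ('a \<Rightarrow> ennreal) \<Rightarrow> 'a \<Rightarrow> ennreal" where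
  "averaging m f x = (\<integral>\<^sup>+ y. f y \<partial>m x)"

(* The variance of a measurable f under a probability measure, with value top if f is not square
   integrable: when f is not even integrable the Bochner mean is 0, and the outer integral
   is then infinite as well. *)
definition evariance :: "'a measure \<Rightarrow> ('a \<Rightarrow> real) \<Rightarrow> ennreal" where
  "evariance \<mu> f = (\<integral>\<^sup>+ y. ennreal ((f y - (\<integral>z. f z \<partial>\<mu>))\<^sup>2) \<partial>\<mu>)"

definition esqrt :: "ennreal \<Rightarrow> ennreal" where
  "esqrt a = (if a = \<infinity> then \<infinity> else ennreal (sqrt (enn2real a)))"

definition spread :: "('a::polish_space \<Rightarrow> 'a measure) \<Rightarrow> 'a \<Rightarrow> ennreal" where
  "spread m x = esqrt ((\<integral>\<^sup>+ z. (\<integral>\<^sup>+ y. ennreal ((dist y z)\<^sup>2) \<partial>m x) \<partial>m x) / 2)"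

(* When m x is a Dirac mass this is 0 / 0 = 0, and (spread m x)^2 / local_dim m x = 0 / 0 = 0
   is still the supremum of the variances. *)
definition local_dim :: "('a::polish_space \<Rightarrow> 'a measure) \<Rightarrow> 'a \<Rightarrow> ennreal" where
  "local_dim m x = (spread m x)\<^sup>2 / (SUP f\<in>{f. 1-lipschitz_on UNIV f}. evariance (m x) f)"

definition supp :: "'a::topological_space measure \<Rightarrow> 'a set" where
  "supp \<mu> = {x. \<forall>A. open A \<longrightarrow> x \<in> A \<longrightarrow> 0 < emeasure \<mu> A}"

(* The library's real-valued diameter is meaningless on unbounded sets. *)
definition ediameter :: "'a::metric_space set \<Rightarrow> ennreal" where
  "ediameter S = (SUP (y, z)\<in>S \<times> S. ennreal (dist y z))"

definition granularity :: "('a::polish_space \<Rightarrow> 'a measure) \<Rightarrow> ennreal" where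
  "granularity m = (SUP x. ediameter (supp (m x)) / 2)"

(* \<xi> x y is the chosen optimal coupling of m x and m y. *)
definition curvature_minus ::
  "('a::polish_space \<Rightarrow> 'a \<Rightarrow> ('a \<times> 'a) measure) \<Rightarrow> 'a \<Rightarrow> 'a \<Rightarrow> ennreal" where
  "curvature_minus \<xi> x y =
     (\<integral>\<^sup>+ (x', y'). ennreal (max 0 (- (dist x y - dist x' y'))) \<partial>\<xi> x y) / ennreal (dist x y)"

definition unstability ::
  "('a::polish_space \<Rightarrow> 'a measure) \<Rightarrow> ('a \<Rightarrow> 'a \<Rightarrow> ('a \<times> 'a) measure) \<Rightarrow> ennreal" where
  "unstability m \<xi> =
     (SUP (x, y)\<in>{(x, y). x \<noteq> y}. curvature_minus \<xi> x y / ennreal (curvature m x y))"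

definition range_gradient :: "real \<Rightarrow> ('a::metric_space \<Rightarrow> real) \<Rightarrow> 'a \<Rightarrow> ennreal" where
  "range_gradient lam f x =
     (SUP (y, y')\<in>{(y, y'). y \<noteq> y'}.
        ennreal (\<bar>f y - f y'\<bar> / dist y y' * exp (- lam * dist x y - lam * dist x y')))"

(* The integral of f ln f, whose negative part is bounded on a probability space, is taken in
   (-infinity, infinity]; so the entropy is infinite rather than junk if f ln f is not integrable.
   A Bochner mean of 0 for a non-integrable f > 0 is harmless: f ln f then has integral infinity. *)
definition eentropy :: "'a measure \<Rightarrow> ('a \<Rightarrow> real) \<Rightarrow> ereal" where
  "eentropy \<nu> f =
     enn2ereal (\<integral>\<^sup>+ x. ennreal (max 0 (f x * ln (f x))) \<partial>\<nu>)
       - enn2ereal (\<integral>\<^sup>+ x. ennreal (max 0 (- (f x * ln (f x)))) \<partial>\<nu>)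
       - ereal ((\<integral>x. f x \<partial>\<nu>) * ln (\<integral>x. f x \<partial>\<nu>))"

definition local_weight :: "('a::polish_space \<Rightarrow> 'a measure) \<Rightarrow> real \<Rightarrow> 'a \<Rightarrow> ennreal" where
  "local_weight m \<kappa> x =
     2 * (\<Sum>t. ennreal ((1 - \<kappa> / 2) ^ (2 * t))
              * (averaging m ^^ (t + 1)) (\<lambda>y. (spread m y)\<^sup>2 / local_dim m y) x)"

end

theory Submission
  imports Defs
begin

text \<open>Write \<open>F = Df\<close> and \<open>M\<close> for averaging. The range gradient varies slowly,
  \<open>F w \<le> exp (2 \<lambda> d(w, w')) F w'\<close>, and controls \<open>f\<close> from a single base point,
  \<open>\<bar>f z - f z'\<bar> \<le> d(z, z') exp (\<lambda> d(z, z')) F z\<close>. Both properties pass from \<open>(f, F)\<close> to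
  \<open>(M f, (1 - \<kappa>/2) M F)\<close>: on the support of one \<open>m x\<close> the weight \<open>F\<close> is constant up to the factor
  \<open>exp (4 \<lambda> \<sigma>)\<close>, so the gain from \<open>\<kappa>\<^sub>+ = \<kappa> + \<kappa>\<^sub>-\<close> outweighs the loss from \<open>\<kappa>\<^sub>- \<le> U \<kappa>\<close> as soon as
  \<open>\<lambda> \<sigma> (1 + U) \<le> 1/24\<close>. One base point suffices here. The three-point inequality
  \<open>D(M f) \<le> (1 - \<kappa>/2) M(D f)\<close> is not used, since optimal couplings of three measures need not be
  compatible with each other.

  Hence \<open>M\<^sup>t f\<close> is Lipschitz on the support of \<open>m x\<close> with constant at most
  \<open>\<surd>2 (1 - \<kappa>/2)\<^sup>t M\<^sup>t\<^sup>+\<^sup>1 F x\<close>, which bounds its variance under \<open>m x\<close>. Telescoping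
  \<open>\<integral> \<Phi> (M\<^sup>t f) d\<nu>\<close> for \<open>\<Phi> u = u\<^sup>2\<close> and for \<open>\<Phi> u = u ln u\<close> expresses the variance and the entropy
  through these local variances, and the Cauchy-Schwarz inequality
  \<open>(M\<^sup>n F)\<^sup>2 / M\<^sup>n v \<le> M\<^sup>n (F\<^sup>2 / v)\<close>, with \<open>v = 1\<close> or \<open>v = f\<close>, removes the iterates by invariance
  or moves them to the weight by reversibility. Both \<open>f\<close> and \<open>F\<close> are bounded \<open>\<nu>\<close>-almost
  everywhere because \<open>\<nu>\<close> has bounded support.\<close>

section \<open>Supports, integrals and estimates for the exponential\<close>

text \<open>By second countability the complement of the support is covered by countably many basic
  open sets of measure zero.\<close>

lemma AE_supp:
  fixes \<mu> :: "'a::second_countable_topology measure"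
  assumes "sets \<mu> = sets borel"
  shows "AE x in \<mu>. x \<in> supp \<mu>"
proof -
  obtain B :: "'a set set" where B: "countable B" "topological_basis B"
    using ex_countable_basis by blast
  let ?N = "{b\<in>B. emeasure \<mu> b = 0}"
  have "(\<Union>b\<in>?N. b) \<in> null_sets \<mu>"
  proof (rule null_sets_UN')
    show "countable ?N" using B(1) by (rule countable_subset[rotated]) auto
    show "\<And>b. b \<in> ?N \<Longrightarrow> b \<in> null_sets \<mu>"
      using assms topological_basis_open[OF B(2)] by (auto simp: null_sets_def)
  qed
  moreover have "{x \<in> space \<mu>. \<not> x \<in> supp \<mu>} \<subseteq> (\<Union>b\<in>?N. b)"
  proof
    fix x assume "x \<in> {x \<in> space \<mu>. \<not> x \<in> supp \<mu>}"
    then obtain A where A: "open A" "x \<in> A" "emeasure \<mu> A = 0" by (auto simp: supp_def)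
    then obtain b where b: "b \<in> B" "x \<in> b" "b \<subseteq> A" using B(2) topological_basisE by metis
    have "emeasure \<mu> b \<le> emeasure \<mu> A"
      using A(1) assms by (intro emeasure_mono b(3)) auto
    then show "x \<in> (\<Union>b\<in>?N. b)" using b A(3) by auto
  qed
  ultimately show ?thesis by (intro AE_I')
qed

lemma polish_borel_pair:
  "(borel :: ('a::second_countable_topology \<times> 'b::second_countable_topology) measure) = borel \<Otimes>\<^sub>M borel"
  by (simp add: borel_prod)

lemma integrable_AE_bounded:
  fixes f :: "'a \<Rightarrow> real"
  assumes "prob_space M" "f \<in> borel_measurable M" "AE x in M. \<bar>f x\<bar> \<le> B"
  shows "integrable M f"
proof -
  interpret prob_space M by fact
  show ?thesis by (rule integrable_const_bound[of _ B]) (use assms in auto)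
qed

lemma ennreal_integral_le_nn_integral:
  fixes f :: "'a \<Rightarrow> real"
  assumes "integrable M f"
  shows "ennreal (\<integral>x. f x \<partial>M) \<le> (\<integral>\<^sup>+x. ennreal (f x) \<partial>M)"
proof -
  have "ennreal (\<integral>x. f x \<partial>M) \<le> ennreal (\<integral>x. max 0 (f x) \<partial>M)"
    by (intro ennreal_leI integral_mono assms integrable_max) auto
  also have "\<dots> = (\<integral>\<^sup>+x. ennreal (max 0 (f x)) \<partial>M)"
    by (intro nn_integral_eq_integral[symmetric] integrable_max assms) auto
  also have "\<dots> = (\<integral>\<^sup>+x. ennreal (f x) \<partial>M)"
    by (intro nn_integral_cong) (auto simp: max_def ennreal_neg)
  finally show ?thesis .
qed

lemma prob_AE_ex:
  assumes "prob_space M" "AE x in M. P x"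
  shows "\<exists>x. P x"
  using assms by (metis (mono_tags, lifting) AE_E2 AE_iff_measurable eventually_mono prob_space.AE_False)

text \<open>Growth and decay get separate slopes, so that increases and decreases of distance can be
  weighed against each other later. For s \<ge> 0 the bound is
  \<open>exp s - 1 \<le> exp s * s\<close>. For s < 0 the cubic Taylor remainder is nonpositive,
  which leaves 1 + s + s^2 / 2, and s^2 \<le> r |s|.\<close>

lemma exp_minus_one_bounds:
  fixes s :: real
  assumes "\<bar>s\<bar> \<le> r"
  shows "exp s - 1 \<le> exp r * max 0 s - (1 - r / 2) * max 0 (- s)"
proof (cases "0 \<le> s")
  case True
  have "1 - s \<le> exp (- s)" using exp_ge_add_one_self[of "-s"] by simp
  then have "exp s * (1 - s) \<le> 1"
    by (metis exp_ge_zero exp_minus_inverse mult_left_mono)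
  then have "exp s - 1 \<le> exp s * s" by (simp add: algebra_simps)
  also have "\<dots> \<le> exp r * s" using True assms by (intro mult_right_mono) auto
  finally show ?thesis using True by simp
next
  case False
  have "exp s \<le> 1 + s + s\<^sup>2 / 2"
  proof -
    have "\<exists>t. \<bar>t\<bar> \<le> \<bar>s\<bar> \<and> exp s = (\<Sum>m<3. s ^ m / fact m) + exp t / fact 3 * s ^ 3"
      by (rule Maclaurin_exp_le)
    then obtain t where t: "exp s = (\<Sum>m<3. s ^ m / fact m) + exp t / fact 3 * s ^ 3" by blast
    have "s ^ 3 \<le> 0" using False by (auto simp: power3_eq_cube mult_nonneg_nonpos mult_nonneg_nonneg not_le mult_neg_neg less_imp_le mult_pos_neg)
    then have "exp t / fact 3 * s ^ 3 \<le> 0" by (intro mult_nonneg_nonpos) auto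
    then show ?thesis using t by (simp add: numeral_eq_Suc)
  qed
  moreover have "s\<^sup>2 \<le> r * - s"
  proof -
    have "s\<^sup>2 = (-s) * (-s)" by (simp add: power2_eq_square)
    also have "\<dots> \<le> r * - s" using False assms by (intro mult_right_mono) auto
    finally show ?thesis .
  qed
  ultimately show ?thesis using False by (simp add: algebra_simps)
qed

lemma exp_le_quadratic: "0 \<le> (x::real) \<Longrightarrow> x \<le> 1 \<Longrightarrow> exp x \<le> 1 + x + x\<^sup>2"
  by (rule exp_bound)

text \<open>In the applications \<open>s\<close> is the change of distance under a coupling,
  \<open>k\<close> its mean decrease, and \<open>G\<close> a weight that oscillates by a factor
  \<open>E\<close>. Increases are charged with the largest weight and decreases with the smallest.
  The mean of the negative part is \<open>k\<close> plus the mean of the positive part (the identity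
  \<kappa>+ = \<kappa> + \<kappa>-), so the bound \<open>U * k\<close> on the positive part controls
  everything.\<close>

lemma weighted_deviation_le:
  fixes G h s :: "'a \<Rightarrow> real"
  assumes M: "prob_space M"
    and int: "integrable M s" "integrable M (\<lambda>p. G p * h p)"
    and g: "0 \<le> g" "AE p in M. g \<le> G p \<and> G p \<le> E * g"
    and h: "AE p in M. h p \<le> C * (B * max 0 (s p) - D * max 0 (- s p))"
    and nn: "0 \<le> C" "0 \<le> B" "0 \<le> D"
    and mean: "(\<integral>p. s p \<partial>M) = - k" "(\<integral>p. max 0 (s p) \<partial>M) \<le> U * k"
    and DEB: "D \<le> E * B"
  shows "(\<integral>p. G p * h p \<partial>M) \<le> - (C * g * k * (D - U * (E * B - D)))"
proof -
  interpret prob_space M by fact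
  have i1: "integrable M (\<lambda>p. max 0 (s p))" "integrable M (\<lambda>p. max 0 (- s p))"
    by (intro integrable_max integrable_minus int; simp)+
  have "(\<integral>p. max 0 (s p) - max 0 (- s p) \<partial>M) = - k"
    by (subst mean(1)[symmetric], intro Bochner_Integration.integral_cong) (auto simp: max_def)
  then have neg: "(\<integral>p. max 0 (- s p) \<partial>M) = (\<integral>p. max 0 (s p) \<partial>M) + k"
    using i1 by (simp add: Bochner_Integration.integral_diff)
  have "(\<integral>p. G p * h p \<partial>M) \<le> (\<integral>p. C * g * (E * B * max 0 (s p) - D * max 0 (- s p)) \<partial>M)"
  proof (rule integral_mono_AE[OF int(2)])
    show "integrable M (\<lambda>p. C * g * (E * B * max 0 (s p) - D * max 0 (- s p)))"
      by (intro integrable_mult_right Bochner_Integration.integrable_diff i1)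
    show "AE p in M. G p * h p \<le> C * g * (E * B * max 0 (s p) - D * max 0 (- s p))"
      using g(2) h
    proof eventually_elim
      case (elim p)
      have "G p * h p \<le> G p * (C * (B * max 0 (s p) - D * max 0 (- s p)))"
        using elim g(1) by (intro mult_left_mono) auto
      also have "\<dots> = C * (B * max 0 (s p) * G p - D * max 0 (- s p) * G p)"
        by (simp add: algebra_simps)
      also have "\<dots> \<le> C * (B * max 0 (s p) * (E * g) - D * max 0 (- s p) * g)"
        using elim nn g(1) by (intro mult_left_mono diff_mono) auto
      finally show ?case by (simp add: algebra_simps)
    qed
  qed
  also have "\<dots> = C * g * (E * B * (\<integral>p. max 0 (s p) \<partial>M) - D * ((\<integral>p. max 0 (s p) \<partial>M) + k))"
    using i1 by (simp add: neg Bochner_Integration.integral_diff)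
  also have "\<dots> = C * g * ((E * B - D) * (\<integral>p. max 0 (s p) \<partial>M) - D * k)"
    by (simp add: algebra_simps)
  \<comment> \<open>The coefficient \<open>E * B - D\<close> is nonnegative by \<open>DEB\<close>,
    so the mean of the positive part may be replaced by its upper bound.\<close>
  also have "\<dots> \<le> C * g * ((E * B - D) * (U * k) - D * k)"
    using mean(2) nn g(1) DEB by (intro mult_left_mono diff_mono) auto
  finally show ?thesis by (simp add: algebra_simps)
qed

section \<open>Tame functions, slow variation and gradient bounds\<close>

definition avg :: "('a \<Rightarrow> 'a measure) \<Rightarrow> ('a \<Rightarrow> real) \<Rightarrow> 'a \<Rightarrow> real" where
  "avg m g x = (\<integral>y. g y \<partial>m x)"

text \<open>The working class of functions: each \<open>m x\<close> and \<nu> will turn out to live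
  on a bounded set, so tame functions are integrable for all of them, and averaging will preserve
  the class.\<close>

definition tame :: "('a::metric_space \<Rightarrow> real) \<Rightarrow> bool" where
  "tame g \<longleftrightarrow> g \<in> borel_measurable borel \<and> (\<forall>S. bounded S \<longrightarrow> bounded (g ` S))"

lemma tame_const: "tame (\<lambda>_. c)"
  by (auto simp: tame_def image_def intro: finite_imp_bounded finite_subset[of _ "{c}"])

lemma tameD:
  assumes "tame g" "bounded S"
  obtains B where "0 \<le> B" "\<And>x. x \<in> S \<Longrightarrow> \<bar>g x\<bar> \<le> B"
proof -
  have "bounded (g ` S)" using assms by (auto simp: tame_def)
  then obtain B where "\<And>x. x \<in> S \<Longrightarrow> \<bar>g x\<bar> \<le> B" by (auto simp: bounded_iff)
  then show ?thesis by (intro that[of "max 0 B"]) (auto simp: max_def, force)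
qed

text \<open>The 2 in the exponent stems from the two distances \<open>dist x y\<close> and
  \<open>dist x y'\<close> in the weight of the range gradient.\<close>

definition slowly_varying :: "real \<Rightarrow> ('a::metric_space \<Rightarrow> real) \<Rightarrow> bool" where
  "slowly_varying lam F \<longleftrightarrow>
     (\<forall>w. 0 \<le> F w) \<and> (\<forall>w w'. F w \<le> exp (2 * lam * dist w w') * F w')"

text \<open>For \<open>F\<close> the range gradient, this is its supremum restricted to pairs whose
  first point is the base point \<open>z\<close>.\<close>

definition gradient_bound :: "real \<Rightarrow> ('a::metric_space \<Rightarrow> real) \<Rightarrow> ('a \<Rightarrow> real) \<Rightarrow> bool" where
  "gradient_bound lam f F \<longleftrightarrow>
     (\<forall>z z'. \<bar>f z - f z'\<bar> \<le> dist z z' * exp (lam * dist z z') * F z)"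

lemma continuous_imp_tame_measurable:
  fixes g :: "'a::metric_space \<Rightarrow> real"
  assumes "\<And>z. isCont g z"
  shows "g \<in> borel_measurable borel"
  using assms by (intro borel_measurable_continuous_onI) (auto intro: continuous_at_imp_continuous_on)

text \<open>Slow variation in both directions squeezes \<open>F\<close> near \<open>z\<close>.
  Measurability of the range gradient, a supremum over possibly uncountably many pairs, is obtained
  through this continuity.\<close>

lemma slowly_varying_isCont:
  assumes "slowly_varying lam F"
  shows "isCont F z"
  unfolding isCont_def
proof (rule tendsto_sandwich)
  show "\<forall>\<^sub>F w in at z. exp (- (2 * lam * dist z w)) * F z \<le> F w"
  proof (rule always_eventually, rule allI)
    fix w
    have "F z \<le> exp (2 * lam * dist z w) * F w" using assms by (auto simp: slowly_varying_def)
    then show "exp (- (2 * lam * dist z w)) * F z \<le> F w"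
      by (simp add: exp_minus field_simps)
  qed
  show "\<forall>\<^sub>F w in at z. F w \<le> exp (2 * lam * dist w z) * F z"
    using assms by (intro always_eventually) (auto simp: slowly_varying_def)
  have "((\<lambda>w. exp (- (2 * lam * dist z w)) * F z) \<longlongrightarrow> exp (- (2 * lam * dist z z)) * F z) (at z)"
    by (intro tendsto_intros)
  then show "((\<lambda>w. exp (- (2 * lam * dist z w)) * F z) \<longlongrightarrow> F z) (at z)" by simp
  have "((\<lambda>w. exp (2 * lam * dist w z) * F z) \<longlongrightarrow> exp (2 * lam * dist z z) * F z) (at z)"
    by (intro tendsto_intros)
  then show "((\<lambda>w. exp (2 * lam * dist w z) * F z) \<longlongrightarrow> F z) (at z)" by simp
qed

lemma slowly_varying_tame:
  assumes F: "slowly_varying lam F" and lam: "0 \<le> lam"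
  shows "tame F"
  unfolding tame_def
proof (intro conjI allI impI)
  show "F \<in> borel_measurable borel"
    by (intro continuous_imp_tame_measurable slowly_varying_isCont[OF F])
  fix S :: "'a set" assume "bounded S"
  then obtain o' e where S: "\<And>y. y \<in> S \<Longrightarrow> dist o' y \<le> e" by (auto simp: bounded_def)
  show "bounded (F ` S)"
    unfolding bounded_iff
  proof (intro exI[of _ "exp (2 * lam * e) * F o'"] ballI)
    fix u assume "u \<in> F ` S"
    then obtain y where y: "y \<in> S" "u = F y" by auto
    have "F y \<le> exp (2 * lam * dist y o') * F o'" "0 \<le> F y" "0 \<le> F o'"
      using F by (auto simp: slowly_varying_def)
    moreover have "exp (2 * lam * dist y o') * F o' \<le> exp (2 * lam * e) * F o'"
      using S[OF y(1)] lam \<open>0 \<le> F o'\<close>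
      by (intro mult_right_mono) (auto simp: dist_commute intro!: mult_left_mono)
    ultimately show "norm u \<le> exp (2 * lam * e) * F o'" using y by auto
  qed
qed

text \<open>The measurability of \<open>f\<close> and of its iterates comes from this
  continuity.\<close>

lemma gradient_bound_isCont:
  assumes "gradient_bound lam f F"
  shows "isCont f z"
proof -
  have "((\<lambda>w. dist z w * exp (lam * dist z w) * F z) \<longlongrightarrow> dist z z * exp (lam * dist z z) * F z) (at z)"
    by (intro tendsto_intros)
  then have 1: "((\<lambda>w. dist z w * exp (lam * dist z w) * F z) \<longlongrightarrow> 0) (at z)" by simp
  have "norm (f w - f z) \<le> dist z w * exp (lam * dist z w) * F z" for w
    using assms by (simp add: gradient_bound_def abs_minus_commute[of "f w"])
  then have "((\<lambda>w. f w - f z) \<longlongrightarrow> 0) (at z)"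
    by (intro Lim_null_comparison[OF _ 1] always_eventually) simp
  then show ?thesis unfolding isCont_def by (rule LIM_zero_cancel)
qed

lemma gradient_bound_tame:
  assumes f: "gradient_bound lam f F" and F: "slowly_varying lam F" and lam: "0 \<le> lam"
  shows "tame f"
  unfolding tame_def
proof (intro conjI allI impI)
  show "f \<in> borel_measurable borel"
    by (intro continuous_imp_tame_measurable gradient_bound_isCont[OF f])
  fix S :: "'a set" assume "bounded S"
  then obtain o' e where S: "\<And>y. y \<in> S \<Longrightarrow> dist o' y \<le> e" by (auto simp: bounded_def)
  show "bounded (f ` S)"
    unfolding bounded_iff
  proof (intro exI[of _ "\<bar>f o'\<bar> + e * exp (lam * e) * F o'"] ballI)
    fix u assume "u \<in> f ` S"
    then obtain y where y: "y \<in> S" "u = f y" by auto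
    have "\<bar>f o' - f y\<bar> \<le> dist o' y * exp (lam * dist o' y) * F o'"
      using f by (auto simp: gradient_bound_def)
    also have "\<dots> \<le> e * exp (lam * e) * F o'"
      using S[OF y(1)] lam F order_trans[OF zero_le_dist S[OF y(1)]]
      by (intro mult_right_mono mult_mono) (auto simp: slowly_varying_def intro!: mult_left_mono)
    finally show "norm u \<le> \<bar>f o'\<bar> + e * exp (lam * e) * F o'" using y by auto
  qed
qed

section \<open>Walks whose steps have uniformly bounded support\<close>

text \<open>Here \<open>\<sigma>\<close> stands for the granularity sigma_infinity as a real number,
  not for the spread.\<close>

locale bounded_walk =
  fixes m :: "'a::polish_space \<Rightarrow> 'a measure" and \<sigma> :: real
  assumes kernel: "m \<in> borel \<rightarrow>\<^sub>M prob_algebra borel"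
    and supp_dist: "\<And>x y z. y \<in> supp (m x) \<Longrightarrow> z \<in> supp (m x) \<Longrightarrow> dist y z \<le> 2 * \<sigma>"
begin

lemma prob: "prob_space (m x)"
  using measurable_space[OF kernel, of x] by (auto simp: space_prob_algebra)

lemma sets_m [simp, measurable_cong]: "sets (m x) = sets borel"
  using measurable_space[OF kernel, of x] by (auto simp: space_prob_algebra)

lemma space_m [simp]: "space (m x) = UNIV"
  using sets_eq_imp_space_eq[OF sets_m] by simp

lemma subprob_kernel [measurable]: "m \<in> borel \<rightarrow>\<^sub>M subprob_algebra borel"
  by (rule measurable_prob_algebraD[OF kernel])

lemma AE_m_supp: "AE y in m x. y \<in> supp (m x)"
  by (rule AE_supp) simp

lemma supp_nonempty: "\<exists>y. y \<in> supp (m x)"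
  by (rule prob_AE_ex[OF prob AE_m_supp])

lemma sigma_nonneg: "0 \<le> \<sigma>"
proof -
  obtain y where "y \<in> supp (m undefined)" using supp_nonempty by blast
  from supp_dist[OF this this] show ?thesis by simp
qed

lemma bounded_supp: "bounded (supp (m x))"
proof -
  obtain y where "y \<in> supp (m x)" using supp_nonempty by blast
  then show ?thesis unfolding bounded_def using supp_dist by blast
qed

lemma tame_integrable:
  assumes "tame g"
  shows "integrable (m x) g"
proof -
  obtain B where B: "\<And>y. y \<in> supp (m x) \<Longrightarrow> \<bar>g y\<bar> \<le> B"
    using tameD[OF assms bounded_supp] by metis
  show ?thesis
    by (rule integrable_AE_bounded[OF prob, of _ _ B])
      (use assms AE_m_supp[of x] B in \<open>auto simp: tame_def measurable_cong_sets[OF sets_m refl] elim!: eventually_mono\<close>)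
qed

lemma measurable_avg:
  assumes "tame g"
  shows "avg m g \<in> borel_measurable borel"
proof -
  have [measurable]: "g \<in> borel_measurable borel" using assms by (auto simp: tame_def)
  \<comment> \<open>The Bochner integral is split into two nonnegative integrals, each of which
    depends measurably on \<open>x\<close> through the kernel.\<close>
  have "avg m g = (\<lambda>x. enn2real (\<integral>\<^sup>+y. ennreal (g y) \<partial>m x) - enn2real (\<integral>\<^sup>+y. ennreal (- g y) \<partial>m x))"
    by (intro ext) (simp add: avg_def real_lebesgue_integral_def[OF tame_integrable[OF assms]])
  also have "\<dots> \<in> borel_measurable borel"
    by (intro borel_measurable_diff borel_measurable_enn2real
        nn_integral_measurable_subprob_algebra2[where N=borel]) measurable
  finally show ?thesis .
qed

lemma avg_mono:
  assumes "tame g" "tame h" "\<And>y. y \<in> supp (m x) \<Longrightarrow> g y \<le> h y"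
  shows "avg m g x \<le> avg m h x"
  unfolding avg_def using assms(3) AE_m_supp[of x]
  by (intro integral_mono_AE tame_integrable assms(1,2)) (auto elim!: eventually_mono)

lemma avg_const [simp]: "avg m (\<lambda>_. c) x = c"
  using prob_space.prob_space[OF prob, of x] by (simp add: avg_def)

text \<open>The infimum of \<open>F\<close> over the support serves as \<open>g\<close>. Two points
  of the support are at most \<open>2 * \<sigma>\<close> apart, so slow variation costs at most the
  factor exp (2 lam * 2 \<sigma>).\<close>

lemma slowly_varying_supp:
  assumes "slowly_varying lam F" "0 \<le> lam"
  shows "\<exists>g\<ge>0. \<forall>z\<in>supp (m x). g \<le> F z \<and> F z \<le> exp (4 * (lam * \<sigma>)) * g"
proof (intro exI[of _ "INF z\<in>supp (m x). F z"] conjI ballI)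
  have nn: "0 \<le> F z" for z using assms(1) by (auto simp: slowly_varying_def)
  have bb: "bdd_below (F ` supp (m x))" using nn by (intro bdd_belowI[of _ 0]) auto
  show "0 \<le> (INF z\<in>supp (m x). F z)"
    using supp_nonempty[of x] nn by (intro cINF_greatest) auto
  fix z assume z: "z \<in> supp (m x)"
  then show "(INF z\<in>supp (m x). F z) \<le> F z" by (intro cINF_lower bb)
  have "exp (- (4 * (lam * \<sigma>))) * F z \<le> (INF z\<in>supp (m x). F z)"
  proof (rule cINF_greatest)
    fix w assume w: "w \<in> supp (m x)"
    have "F z \<le> exp (2 * lam * dist z w) * F w" using assms(1) by (auto simp: slowly_varying_def)
    also have "\<dots> \<le> exp (4 * (lam * \<sigma>)) * F w"
    proof (intro mult_right_mono nn)
      have "2 * lam * dist z w \<le> 2 * lam * (2 * \<sigma>)"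
        using supp_dist[OF z w] assms(2) by (intro mult_left_mono) auto
      then show "exp (2 * lam * dist z w) \<le> exp (4 * (lam * \<sigma>))" by simp
    qed
    finally show "exp (- (4 * (lam * \<sigma>))) * F z \<le> F w" by (simp add: exp_minus field_simps)
  qed (use z in auto)
  then show "F z \<le> exp (4 * (lam * \<sigma>)) * (INF z\<in>supp (m x). F z)"
    by (simp add: exp_minus field_simps)
qed

end

subsection \<open>Contraction of gradient bounds\<close>

text \<open>The instability bound is guarded by \<open>0 < \<sigma>\<close> because the hypothesis
  of the theorem on \<open>lam\<close> yields a finite unstability only then; for \<sigma> = 0 the
  number \<open>U\<close> will be set to 0. The bound \<kappa> \<le> 1 holds as soon as there are
  two distinct points, since curvature never exceeds 1.\<close>

locale contracting_walk = bounded_walk m \<sigma>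
  for m :: "'a::polish_space \<Rightarrow> 'a measure" and \<sigma> :: real +
  fixes \<xi> :: "'a \<Rightarrow> 'a \<Rightarrow> ('a \<times> 'a) measure" and \<kappa> U lam :: real
  assumes coupling_\<xi>: "\<And>x y. x \<noteq> y \<Longrightarrow> coupling (m x) (m y) (\<xi> x y)"
    and \<kappa>: "0 < \<kappa>" "\<kappa> \<le> 1"
    and lam: "0 < lam"
    and U: "0 \<le> U"
    and lam_small: "lam * \<sigma> * (1 + U) \<le> 1 / 24"
    and contraction: "\<And>x y. x \<noteq> y \<Longrightarrow> (\<integral>p. dist (fst p) (snd p) \<partial>\<xi> x y) \<le> (1 - \<kappa>) * dist x y"
    and unstable: "\<And>x y. x \<noteq> y \<Longrightarrow> 0 < \<sigma> \<Longrightarrow>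
      (\<integral>p. max 0 (dist (fst p) (snd p) - dist x y) \<partial>\<xi> x y)
        \<le> U * (dist x y - (\<integral>p. dist (fst p) (snd p) \<partial>\<xi> x y))"
begin

lemma sets_\<xi>: "x \<noteq> y \<Longrightarrow> sets (\<xi> x y) = sets borel"
  and distr_fst: "x \<noteq> y \<Longrightarrow> distr (\<xi> x y) borel fst = m x"
  and distr_snd: "x \<noteq> y \<Longrightarrow> distr (\<xi> x y) borel snd = m y"
  using coupling_\<xi>[of x y] by (auto simp: coupling_def)

lemma borel_fst: "fst \<in> borel_measurable (borel :: ('a \<times> 'a) measure)"
  and borel_snd: "snd \<in> borel_measurable (borel :: ('a \<times> 'a) measure)"
  by (intro borel_measurable_continuous_onI continuous_intros)+

lemma borel_dist_pair: "(\<lambda>p. dist (fst p) (snd p)) \<in> borel_measurable (borel :: ('a \<times> 'a) measure)"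
  by (intro borel_measurable_continuous_onI continuous_intros)

lemma meas_\<xi>: "x \<noteq> y \<Longrightarrow> g \<in> measurable borel N \<Longrightarrow> g \<in> measurable (\<xi> x y) N"
  by (simp add: measurable_cong_sets[OF sets_\<xi> refl])

lemma prob_\<xi>:
  assumes "x \<noteq> y"
  shows "prob_space (\<xi> x y)"
proof -
  have "prob_space (distr (\<xi> x y) borel fst)" using prob distr_fst[OF assms] by simp
  then show ?thesis by (rule prob_space_distrD[rotated]) (intro meas_\<xi> assms borel_fst)
qed

lemma AE_\<xi>:
  assumes "x \<noteq> y"
  shows "AE p in \<xi> x y. fst p \<in> supp (m x) \<and> snd p \<in> supp (m y)"
proof -
  have "AE p in \<xi> x y. fst p \<in> supp (m x)"
    by (rule AE_distrD[OF meas_\<xi>[OF assms borel_fst]], unfold distr_fst[OF assms], rule AE_m_supp)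
  moreover have "AE p in \<xi> x y. snd p \<in> supp (m y)"
    by (rule AE_distrD[OF meas_\<xi>[OF assms borel_snd]], unfold distr_snd[OF assms], rule AE_m_supp)
  ultimately show ?thesis by eventually_elim simp
qed

lemma integral_fst:
  assumes "x \<noteq> y" "tame g"
  shows "integrable (\<xi> x y) (\<lambda>p. g (fst p))" "(\<integral>p. g (fst p) \<partial>\<xi> x y) = avg m g x"
proof -
  have g: "g \<in> borel_measurable borel" using assms by (simp add: tame_def)
  show "integrable (\<xi> x y) (\<lambda>p. g (fst p))"
    using tame_integrable[OF assms(2), of x] distr_fst[OF assms(1)]
    by (metis integrable_distr meas_\<xi>[OF assms(1) borel_fst])
  show "(\<integral>p. g (fst p) \<partial>\<xi> x y) = avg m g x"
    unfolding avg_def distr_fst[OF assms(1), symmetric]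
    by (rule integral_distr[symmetric, OF meas_\<xi>[OF assms(1) borel_fst] g])
qed

lemma integral_snd:
  assumes "x \<noteq> y" "tame g"
  shows "integrable (\<xi> x y) (\<lambda>p. g (snd p))" "(\<integral>p. g (snd p) \<partial>\<xi> x y) = avg m g y"
proof -
  have g: "g \<in> borel_measurable borel" using assms by (simp add: tame_def)
  show "integrable (\<xi> x y) (\<lambda>p. g (snd p))"
    using tame_integrable[OF assms(2), of y] distr_snd[OF assms(1)]
    by (metis integrable_distr meas_\<xi>[OF assms(1) borel_snd])
  show "(\<integral>p. g (snd p) \<partial>\<xi> x y) = avg m g y"
    unfolding avg_def distr_snd[OF assms(1), symmetric]
    by (rule integral_distr[symmetric, OF meas_\<xi>[OF assms(1) borel_snd] g])
qed

lemma dist_supp_close: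
  assumes "z \<in> supp (m x)" "z' \<in> supp (m y)" "w \<in> supp (m x)" "w' \<in> supp (m y)"
  shows "\<bar>dist z z' - dist w w'\<bar> \<le> 4 * \<sigma>"
  using supp_dist[OF assms(1,3)] supp_dist[OF assms(2,4)]
    dist_triangle[of z z' w] dist_triangle[of w z' w'] dist_triangle[of w w' z]
    dist_triangle[of z w' z'] dist_commute[of z w] dist_commute[of z' w']
  by linarith

text \<open>The weighted integrands below have this form, an endpoint weight times a function of the
  coupled distance. On the supports this distance stays in a compact interval, on which \<phi> is
  bounded.\<close>

lemma integrable_\<xi>:
  fixes \<phi> :: "real \<Rightarrow> real"
  assumes xy: "x \<noteq> y" and g: "tame g" "h = fst \<or> h = snd" and \<phi>: "continuous_on UNIV \<phi>"
  shows "integrable (\<xi> x y) (\<lambda>p. g (h p) * \<phi> (dist (fst p) (snd p)))"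
proof -
  obtain B where B: "0 \<le> B" "\<And>z. z \<in> supp (m x) \<union> supp (m y) \<Longrightarrow> \<bar>g z\<bar> \<le> B"
    using tameD[OF g(1), of "supp (m x) \<union> supp (m y)"] bounded_supp by (metis bounded_Un)
  obtain w w' where w: "w \<in> supp (m x)" "w' \<in> supp (m y)" using supp_nonempty by metis
  have "compact (\<phi> ` {0..dist w w' + 4 * \<sigma>})"
    by (intro compact_continuous_image continuous_on_subset[OF \<phi>]) auto
  then have "bounded (\<phi> ` {0..dist w w' + 4 * \<sigma>})" by (rule compact_imp_bounded)
  then obtain C where C: "\<And>t. 0 \<le> t \<Longrightarrow> t \<le> dist w w' + 4 * \<sigma> \<Longrightarrow> \<bar>\<phi> t\<bar> \<le> C"
    unfolding bounded_iff by (metis atLeastAtMost_iff imageI real_norm_def)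
  show ?thesis
  proof (rule integrable_AE_bounded[OF prob_\<xi>[OF xy]])
    have h: "h \<in> borel_measurable borel" using g(2) borel_fst borel_snd by auto
    have "(\<lambda>p. g (h p)) \<in> borel_measurable borel"
      using g(1) by (intro measurable_compose[OF h]) (simp add: tame_def)
    moreover have "(\<lambda>p. \<phi> (dist (fst p) (snd p))) \<in> borel_measurable (borel :: ('a \<times> 'a) measure)"
      by (intro measurable_compose[OF borel_dist_pair] borel_measurable_continuous_onI \<phi>)
    ultimately show "(\<lambda>p. g (h p) * \<phi> (dist (fst p) (snd p))) \<in> borel_measurable (\<xi> x y)"
      by (intro meas_\<xi>[OF xy] borel_measurable_times)
    show "AE p in \<xi> x y. \<bar>g (h p) * \<phi> (dist (fst p) (snd p))\<bar> \<le> B * C"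
      using AE_\<xi>[OF xy]
    proof eventually_elim
      case (elim p)
      then have "\<bar>g (h p)\<bar> \<le> B" using B(2) g(2) by auto
      moreover have "\<bar>\<phi> (dist (fst p) (snd p))\<bar> \<le> C"
        using dist_supp_close[of "fst p" x "snd p" y w w'] elim w by (intro C) auto
      ultimately show ?case unfolding abs_mult using B(1) by (intro mult_mono) auto
    qed
  qed
qed

lemma integrable_dist_\<xi>:
  assumes "x \<noteq> y" "continuous_on UNIV (\<phi> :: real \<Rightarrow> real)"
  shows "integrable (\<xi> x y) (\<lambda>p. \<phi> (dist (fst p) (snd p)))"
  using integrable_\<xi>[OF assms(1) tame_const[of 1] _ assms(2), of fst] by simp

text \<open>The coupled distance varies by at most \<open>4 * \<sigma>\<close> over the two
  supports. Its mean lies strictly below \<open>dist x y\<close>, so some pair of support points is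
  no farther apart than \<open>dist x y\<close>. If some other pair is farther apart, then
  \<open>dist x y\<close> lies between two attained values and every coupled distance is within
  \<open>4 * \<sigma>\<close> of it. Otherwise the distance never increases and there is no loss to
  control.\<close>

lemma deviation_cases:
  assumes xy: "x \<noteq> y"
  obtains "AE p in \<xi> x y. dist (fst p) (snd p) \<le> dist x y"
  | "AE p in \<xi> x y. \<bar>dist (fst p) (snd p) - dist x y\<bar> \<le> 4 * \<sigma>"
proof (cases "AE p in \<xi> x y. dist (fst p) (snd p) \<le> dist x y")
  case False
  interpret \<xi>: prob_space "\<xi> x y" by (rule prob_\<xi>[OF xy])
  have "\<exists>p. fst p \<in> supp (m x) \<and> snd p \<in> supp (m y) \<and> dist x y < dist (fst p) (snd p)"
  proof (rule ccontr)
    assume neg: "\<not> ?thesis"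
    have "AE p in \<xi> x y. dist (fst p) (snd p) \<le> dist x y"
      using AE_\<xi>[OF xy] by eventually_elim (use neg in \<open>force simp: not_less\<close>)
    with False show False by simp
  qed
  then obtain p where p: "fst p \<in> supp (m x)" "snd p \<in> supp (m y)" "dist x y < dist (fst p) (snd p)"
    by blast
  have "\<exists>q. fst q \<in> supp (m x) \<and> snd q \<in> supp (m y) \<and> dist (fst q) (snd q) \<le> dist x y"
  proof (rule ccontr)
    assume neg: "\<not> ?thesis"
    have "AE p in \<xi> x y. dist x y \<le> dist (fst p) (snd p)"
      using AE_\<xi>[OF xy] by eventually_elim (use neg in \<open>force simp: not_le\<close>)
    then have "dist x y \<le> (\<integral>p. dist (fst p) (snd p) \<partial>\<xi> x y)"
      by (intro \<xi>.integral_ge_const integrable_dist_\<xi>[OF xy, where \<phi> = "\<lambda>t. t"] continuous_intros)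
    also have "\<dots> \<le> (1 - \<kappa>) * dist x y" by (rule contraction[OF xy])
    finally have "\<kappa> * dist x y \<le> 0" by (simp add: algebra_simps)
    moreover have "0 < \<kappa> * dist x y" using xy \<kappa>(1) by simp
    ultimately show False by simp
  qed
  then obtain q where q: "fst q \<in> supp (m x)" "snd q \<in> supp (m y)" "dist (fst q) (snd q) \<le> dist x y"
    by blast
  have "AE r in \<xi> x y. \<bar>dist (fst r) (snd r) - dist x y\<bar> \<le> 4 * \<sigma>"
    using AE_\<xi>[OF xy]
  proof eventually_elim
    case (elim r)
    then show ?case
      using dist_supp_close[OF p(1,2), of "fst r" "snd r"] dist_supp_close[OF q(1,2), of "fst r" "snd r"] p(3) q(3)
      by linarith
  qed
  then show thesis by (rule that(2))
qed (rule that(1))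

definition \<rho> :: real where "\<rho> = lam * \<sigma>"

lemma \<rho>: "0 \<le> \<rho>" "\<rho> * (1 + U) \<le> 1 / 24" "\<rho> \<le> 1 / 24"
proof -
  show 0: "0 \<le> \<rho>" using lam sigma_nonneg by (simp add: \<rho>_def)
  show 1: "\<rho> * (1 + U) \<le> 1 / 24" using lam_small by (simp add: \<rho>_def)
  have "\<rho> * 1 \<le> \<rho> * (1 + U)" using 0 U by (intro mult_left_mono) auto
  then show "\<rho> \<le> 1 / 24" using 1 by simp
qed

lemma shift_mean:
  assumes xy: "x \<noteq> y"
  shows "(\<integral>p. (dist (fst p) (snd p) - dist x y) \<partial>\<xi> x y)
      = - (dist x y - (\<integral>p. dist (fst p) (snd p) \<partial>\<xi> x y))"
proof -
  interpret \<xi>: prob_space "\<xi> x y" by (rule prob_\<xi>[OF xy])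
  show ?thesis
    using integrable_dist_\<xi>[OF xy, of "\<lambda>t. t"] by (simp add: \<xi>.prob_space)
qed

lemma contraction_gap:
  "x \<noteq> y \<Longrightarrow> \<kappa> * dist x y \<le> dist x y - (\<integral>p. dist (fst p) (snd p) \<partial>\<xi> x y)"
  using contraction[of x y] by (simp add: algebra_simps)

text \<open>This removes the guard on \<open>\<sigma>\<close>: for \<sigma> = 0 closeness makes the
  coupled distance equal to \<open>dist x y\<close>, and the left side vanishes.\<close>

lemma unstable_near:
  assumes xy: "x \<noteq> y" and near: "AE p in \<xi> x y. \<bar>dist (fst p) (snd p) - dist x y\<bar> \<le> 4 * \<sigma>"
  shows "(\<integral>p. max 0 (dist (fst p) (snd p) - dist x y) \<partial>\<xi> x y)
    \<le> U * (dist x y - (\<integral>p. dist (fst p) (snd p) \<partial>\<xi> x y))"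
proof (cases "0 < \<sigma>")
  case False
  then have "\<sigma> = 0" using sigma_nonneg by simp
  then have "(\<integral>p. max 0 (dist (fst p) (snd p) - dist x y) \<partial>\<xi> x y) = 0"
    using near by (intro integral_eq_zero_AE) (auto elim!: eventually_mono)
  moreover have "0 \<le> \<kappa> * dist x y" using \<kappa> by simp
  then have "0 \<le> U * (dist x y - (\<integral>p. dist (fst p) (snd p) \<partial>\<xi> x y))"
    using contraction_gap[OF xy] U by (intro mult_nonneg_nonneg) linarith+
  ultimately show ?thesis by simp
qed (rule unstable[OF xy])

text \<open>Slow variation of \<open>F\<close> along the coupling gives F (fst p) \<le> exp (2 lam
  d) * F (snd p) * exp (2 lam (Z - d)), where Z is the coupled distance and d = d(x, y). It remains
  to see that \<open>exp (2 * lam * (Z - d)) - 1\<close> has nonpositive mean for the weight F (snd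
  p). This holds pointwise if Z never exceeds d, and follows from
  \<open>weighted_deviation_le\<close> if Z stays close to d.\<close>

lemma avg_slowly_varying:
  assumes F: "slowly_varying lam F"
  shows "slowly_varying lam (avg m F)"
  unfolding slowly_varying_def
proof (intro conjI allI)
  have nn: "0 \<le> F z" for z using F by (auto simp: slowly_varying_def)
  have tF: "tame F" using slowly_varying_tame[OF F] lam by simp
  fix x show nn': "0 \<le> avg m F x" unfolding avg_def using nn by (intro integral_nonneg_AE) auto
  fix y
  show "avg m F x \<le> exp (2 * lam * dist x y) * avg m F y"
  proof (cases "x = y")
    case False
    let ?Z = "\<lambda>p::'a\<times>'a. dist (fst p) (snd p)"
    let ?d = "dist x y" and ?k = "dist x y - (\<integral>p. dist (fst p) (snd p) \<partial>\<xi> x y)"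
    let ?h = "\<lambda>p. exp (2 * lam * (?Z p - ?d)) - 1"
    interpret \<xi>: prob_space "\<xi> x y" by (rule prob_\<xi>[OF False])
    have iG: "integrable (\<xi> x y) (\<lambda>p. F (snd p))" by (rule integral_snd[OF False tF])
    have iexp: "integrable (\<xi> x y) (\<lambda>p. F (snd p) * exp (2 * lam * (?Z p - ?d)))"
      by (rule integrable_\<xi>[OF False tF, where \<phi> = "\<lambda>t. exp (2 * lam * (t - ?d))"])
        (auto intro!: continuous_intros)
    have "(\<lambda>p. F (snd p) * ?h p) = (\<lambda>p. F (snd p) * exp (2 * lam * (?Z p - ?d)) - F (snd p))"
      by (simp add: algebra_simps)
    then have ih: "integrable (\<xi> x y) (\<lambda>p. F (snd p) * ?h p)"
      and heq: "(\<integral>p. F (snd p) * ?h p \<partial>\<xi> x y)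
        = (\<integral>p. F (snd p) * exp (2 * lam * (?Z p - ?d)) \<partial>\<xi> x y) - avg m F y"
      using iexp iG integral_snd(2)[OF False tF] by simp_all
    have k: "0 \<le> ?k"
      using contraction_gap[OF False] \<kappa>(1) mult_nonneg_nonneg[of \<kappa> ?d] zero_le_dist[of x y] by linarith
    have "(\<integral>p. F (snd p) * ?h p \<partial>\<xi> x y) \<le> 0"
    proof (rule deviation_cases[OF False])
      assume "AE p in \<xi> x y. ?Z p \<le> ?d"
      then have "AE p in \<xi> x y. F (snd p) * ?h p \<le> 0"
      proof eventually_elim
        case (elim p)
        then have "2 * lam * (?Z p - ?d) \<le> 0" using lam by (simp add: mult_le_0_iff)
        then show ?case using nn[of "snd p"] by (intro mult_nonneg_nonpos) auto
      qed
      then have "(\<integral>p. F (snd p) * ?h p \<partial>\<xi> x y) \<le> (\<integral>p. 0 \<partial>\<xi> x y)"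
        by (intro integral_mono_AE ih) auto
      then show ?thesis by simp
    next
      assume near: "AE p in \<xi> x y. \<bar>?Z p - ?d\<bar> \<le> 4 * \<sigma>"
      obtain g where g: "0 \<le> g" "\<And>z. z \<in> supp (m y) \<Longrightarrow> g \<le> F z \<and> F z \<le> exp (4 * (lam * \<sigma>)) * g"
        using slowly_varying_supp[OF F less_imp_le[OF lam], of y] by blast
      \<comment> \<open>The exponent \<open>2 * lam * (Z - d)\<close> is at most
        \<open>8 * \<rho>\<close> in absolute value, so \<open>exp_minus_one_bounds\<close> yields
        the slopes \<open>exp (8 * \<rho>)\<close> and \<open>1 - 8 * \<rho> / 2\<close>; the weight
        oscillates by \<open>exp (4 * \<rho>)\<close>.\<close>
      let ?D = "1 - 4 * \<rho>"
      have "(\<integral>p. F (snd p) * ?h p \<partial>\<xi> x y)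
        \<le> - ((2 * lam) * g * ?k * (?D - U * (exp (4 * \<rho>) * exp (8 * \<rho>) - ?D)))"
      proof (rule weighted_deviation_le[OF prob_\<xi>[OF False] _ ih, where s = "\<lambda>p. ?Z p - ?d"])
        show "integrable (\<xi> x y) (\<lambda>p. ?Z p - ?d)"
          by (rule integrable_dist_\<xi>[OF False]) (auto intro!: continuous_intros)
        show "AE p in \<xi> x y. g \<le> F (snd p) \<and> F (snd p) \<le> exp (4 * \<rho>) * g"
          using AE_\<xi>[OF False] by eventually_elim (use g(2) in \<open>auto simp: \<rho>_def\<close>)
        show "AE p in \<xi> x y. ?h p \<le> 2 * lam *
            (exp (8 * \<rho>) * max 0 (?Z p - ?d) - ?D * max 0 (- (?Z p - ?d)))"
          using near
        proof eventually_elim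
          case (elim p)
          let ?s = "?Z p - ?d"
          have "\<bar>2 * lam * ?s\<bar> = 2 * lam * \<bar>?s\<bar>" using lam by (simp add: abs_mult)
          also have "\<dots> \<le> 2 * lam * (4 * \<sigma>)" using elim lam by (intro mult_left_mono) auto
          finally have "\<bar>2 * lam * ?s\<bar> \<le> 8 * \<rho>" by (simp add: \<rho>_def)
          from exp_minus_one_bounds[OF this]
          have "?h p \<le> exp (8 * \<rho>) * max 0 (2 * lam * ?s) - (1 - 8 * \<rho> / 2) * max 0 (- (2 * lam * ?s))" .
          moreover have "max 0 (2 * lam * ?s) = 2 * lam * max 0 ?s"
            using lam by (auto simp: max_def zero_le_mult_iff)
          moreover have "max 0 (- (2 * lam * ?s)) = 2 * lam * max 0 (- ?s)"
            using lam by (auto simp: max_def mult_le_0_iff zero_le_mult_iff) (simp add: algebra_simps)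
          ultimately have "?h p \<le> exp (8 * \<rho>) * (2 * lam * max 0 ?s) - (1 - 8 * \<rho> / 2) * (2 * lam * max 0 (- ?s))"
            by (simp only:)
          then show ?case by (simp add: algebra_simps)
        qed
        have "1 \<le> exp (4 * \<rho>) * exp (8 * \<rho>)" using \<rho>(1) by (simp flip: exp_add)
        then show "?D \<le> exp (4 * \<rho>) * exp (8 * \<rho>)" using \<rho>(1) by linarith
      qed (use lam g(1) \<rho> U shift_mean[OF False] unstable_near[OF False near] in auto)
      also have "\<dots> \<le> 0"
      proof -
        \<comment> \<open>As \<rho> \<le> 1/24, the square is at most 6 \<rho>, and 12 + 6 + 4 = 22
          bounds the gap between the slopes by 22 \<rho>. Then 22 U \<rho> = 22 \<rho> (1 + U) - 22
          \<rho> \<le> 22/24 - 22 \<rho>, which is below \<open>?D\<close>.\<close>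
        have "exp (12 * \<rho>) \<le> 1 + 12 * \<rho> + (12 * \<rho>)\<^sup>2"
          using \<rho> by (intro exp_le_quadratic) auto
        also have "(12 * \<rho>)\<^sup>2 \<le> 6 * \<rho>"
          using mult_left_mono[of "144 * \<rho>" 6 \<rho>] \<rho> by (simp add: power2_eq_square)
        finally have "exp (12 * \<rho>) - ?D \<le> 22 * \<rho>" by simp
        then have "U * (exp (12 * \<rho>) - ?D) \<le> U * (22 * \<rho>)" using U by (intro mult_left_mono) auto
        also have "\<dots> = 22 * (\<rho> * (1 + U)) - 22 * \<rho>" by (simp add: algebra_simps)
        also have "\<dots> \<le> ?D" using \<rho> by linarith
        finally have "0 \<le> ?D - U * (exp (4 * \<rho>) * exp (8 * \<rho>) - ?D)" by (simp flip: exp_add)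
        then have "0 \<le> (2 * lam) * g * ?k * (?D - U * (exp (4 * \<rho>) * exp (8 * \<rho>) - ?D))"
          using k lam g(1) by (intro mult_nonneg_nonneg) auto
        then show ?thesis by linarith
      qed
      finally show ?thesis .
    qed
    then have *: "(\<integral>p. F (snd p) * exp (2 * lam * (?Z p - ?d)) \<partial>\<xi> x y) \<le> avg m F y"
      using heq by simp
    have "avg m F x = (\<integral>p. F (fst p) \<partial>\<xi> x y)" by (rule integral_fst(2)[OF False tF, symmetric])
    also have "\<dots> \<le> (\<integral>p. exp (2 * lam * ?d) * (F (snd p) * exp (2 * lam * (?Z p - ?d))) \<partial>\<xi> x y)"
    proof (intro integral_mono integral_fst(1)[OF False tF] integrable_mult_right iexp)
      fix p
      have "F (fst p) \<le> exp (2 * lam * ?Z p) * F (snd p)" using F by (auto simp: slowly_varying_def)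
      also have "\<dots> = exp (2 * lam * ?d) * (F (snd p) * exp (2 * lam * (?Z p - ?d)))"
        by (simp add: right_diff_distrib exp_diff)
      finally show "F (fst p) \<le> exp (2 * lam * ?d) * (F (snd p) * exp (2 * lam * (?Z p - ?d)))" .
    qed
    also have "\<dots> = exp (2 * lam * ?d) * (\<integral>p. F (snd p) * exp (2 * lam * (?Z p - ?d)) \<partial>\<xi> x y)" by simp
    also have "\<dots> \<le> exp (2 * lam * ?d) * avg m F y" using * by simp
    finally show ?thesis .
  qed simp
qed

text \<open>With Z the coupled distance and d = d(x, y), the bound on \<open>f\<close> integrates to
  exp (lam d) times the F (fst p)-weighted mean of Z exp (lam (Z - d)). The weighted mean of Z exp
  (lam (Z - d)) - d must be at most minus half of the mean decrease k of distance, times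
  \<open>avg m F x\<close>. As k \<ge> \<kappa> d, this produces the factor 1 - \<kappa>/2; the
  other half of the gain pays for instability and for the oscillation of \<open>F\<close>.\<close>

lemma avg_gradient_bound:
  assumes f: "gradient_bound lam f F" and F: "slowly_varying lam F"
  shows "gradient_bound lam (avg m f) (\<lambda>x. (1 - \<kappa> / 2) * avg m F x)"
  unfolding gradient_bound_def
proof (intro allI)
  have nn: "0 \<le> F z" for z using F by (auto simp: slowly_varying_def)
  have tF: "tame F" using slowly_varying_tame[OF F] lam by simp
  have tf: "tame f" using gradient_bound_tame[OF f F] lam by simp
  fix x y
  show "\<bar>avg m f x - avg m f y\<bar> \<le> dist x y * exp (lam * dist x y) * ((1 - \<kappa> / 2) * avg m F x)"
  proof (cases "x = y")
    case False
    let ?Z = "\<lambda>p::'a\<times>'a. dist (fst p) (snd p)"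
    let ?d = "dist x y" and ?k = "dist x y - (\<integral>p. dist (fst p) (snd p) \<partial>\<xi> x y)"
    let ?\<phi> = "\<lambda>p. ?Z p * exp (lam * (?Z p - ?d))"
    let ?h = "\<lambda>p. ?\<phi> p - ?d"
    interpret \<xi>: prob_space "\<xi> x y" by (rule prob_\<xi>[OF False])
    have iG: "integrable (\<xi> x y) (\<lambda>p. F (fst p))" by (rule integral_fst[OF False tF])
    have iexp: "integrable (\<xi> x y) (\<lambda>p. F (fst p) * ?\<phi> p)"
      by (rule integrable_\<xi>[OF False tF, where \<phi> = "\<lambda>t. t * exp (lam * (t - ?d))"])
        (auto intro!: continuous_intros)
    have "(\<lambda>p. F (fst p) * ?h p) = (\<lambda>p. F (fst p) * ?\<phi> p - ?d * F (fst p))"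
      by (simp add: algebra_simps)
    then have ih: "integrable (\<xi> x y) (\<lambda>p. F (fst p) * ?h p)"
      and heq: "(\<integral>p. F (fst p) * ?h p \<partial>\<xi> x y) = (\<integral>p. F (fst p) * ?\<phi> p \<partial>\<xi> x y) - ?d * avg m F x"
      using iexp iG integral_fst(2)[OF False tF] by simp_all
    have k\<kappa>: "\<kappa> * ?d \<le> ?k" by (rule contraction_gap[OF False])
    have k: "0 \<le> ?k" using k\<kappa> \<kappa>(1) mult_nonneg_nonneg[of \<kappa> ?d] zero_le_dist[of x y] by linarith
    obtain g where g: "0 \<le> g" "\<And>z. z \<in> supp (m x) \<Longrightarrow> g \<le> F z \<and> F z \<le> exp (4 * (lam * \<sigma>)) * g"
      using slowly_varying_supp[OF F less_imp_le[OF lam], of x] by blast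
    have AEg: "AE p in \<xi> x y. g \<le> F (fst p) \<and> F (fst p) \<le> exp (4 * \<rho>) * g"
      using AE_\<xi>[OF False] by eventually_elim (use g(2) in \<open>auto simp: \<rho>_def\<close>)
    have Fg: "avg m F x \<le> exp (4 * \<rho>) * g"
    proof -
      have "avg m F x \<le> avg m (\<lambda>_. exp (4 * \<rho>) * g) x"
        using g(2) by (intro avg_mono tF tame_const) (auto simp: \<rho>_def)
      then show ?thesis by simp
    qed
    have int_s: "integrable (\<xi> x y) (\<lambda>p. ?Z p - ?d)"
      by (rule integrable_dist_\<xi>[OF False]) (auto intro!: continuous_intros)
    have e4: "exp (4 * \<rho>) \<le> 1 + 4 * \<rho> + 2/3 * \<rho>"
    proof -
      have "exp (4 * \<rho>) \<le> 1 + 4 * \<rho> + (4 * \<rho>)\<^sup>2" using \<rho> by (intro exp_le_quadratic) auto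
      also have "(4 * \<rho>)\<^sup>2 \<le> 2/3 * \<rho>"
        using mult_left_mono[of "16 * \<rho>" "2/3" \<rho>] \<rho> by (simp add: power2_eq_square)
      finally show ?thesis by simp
    qed
    \<comment> \<open>The constant is half of the bound 1 + 4 \<rho> + (2/3) \<rho> on
      \<open>exp (4 * \<rho>)\<close>. This is the margin that later permits replacing the lower
      weight \<open>g\<close> by \<open>avg m F x\<close>, which may be as large as
      \<open>exp (4 * \<rho>) * g\<close>.\<close>
    have "(\<integral>p. F (fst p) * ?h p \<partial>\<xi> x y) \<le> - (g * ?k * (1 / 2 + 4 / 3 * \<rho> + \<rho>))"
    proof (rule deviation_cases[OF False])
      assume small: "AE p in \<xi> x y. ?Z p \<le> ?d"
      have "(\<integral>p. F (fst p) * ?h p \<partial>\<xi> x y) \<le> (\<integral>p. g * (?Z p - ?d) \<partial>\<xi> x y)"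
      proof (intro integral_mono_AE ih integrable_mult_right int_s)
        show "AE p in \<xi> x y. F (fst p) * ?h p \<le> g * (?Z p - ?d)"
          using small AEg
        proof eventually_elim
          case (elim p)
          then have "lam * (?Z p - ?d) \<le> 0" using lam by (simp add: mult_le_0_iff)
          then have "?\<phi> p \<le> ?Z p * 1" by (intro mult_left_mono) auto
          then have "F (fst p) * ?h p \<le> F (fst p) * (?Z p - ?d)"
            using nn by (intro mult_left_mono) auto
          also have "\<dots> \<le> g * (?Z p - ?d)" using elim by (intro mult_right_mono_neg) auto
          finally show ?case .
        qed
      qed
      also have "\<dots> = - (g * ?k * 1)" by (simp only: integral_mult_right_zero shift_mean[OF False] mult_minus_right mult_1_right)
      also have "\<dots> \<le> - (g * ?k * (1 / 2 + 4 / 3 * \<rho> + \<rho>))"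
        using \<rho> g(1) k by (intro le_imp_neg_le mult_left_mono mult_nonneg_nonneg) auto
      finally show ?thesis .
    next
      assume near: "AE p in \<xi> x y. \<bar>?Z p - ?d\<bar> \<le> 4 * \<sigma>"
      let ?D = "1 - 4 * \<rho>"
      \<comment> \<open>The factor \<open>1 + lam * ?d\<close> is the derivative of t exp (lam (t -
        d)) at t = d. Here |lam (Z - d)| \<le> 4 \<rho>, and the decreasing side keeps the slope
        \<open>1 - 4 * \<rho>\<close>.\<close>
      have "(\<integral>p. F (fst p) * ?h p \<partial>\<xi> x y)
        \<le> - ((1 + lam * ?d) * g * ?k * (?D - U * (exp (4 * \<rho>) * exp (4 * \<rho>) - ?D)))"
      proof (rule weighted_deviation_le[OF prob_\<xi>[OF False] int_s ih g(1) AEg])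
        show "AE p in \<xi> x y. ?h p \<le> (1 + lam * ?d) *
            (exp (4 * \<rho>) * max 0 (?Z p - ?d) - ?D * max 0 (- (?Z p - ?d)))"
          using near
        proof eventually_elim
          case (elim p)
          let ?s = "?Z p - ?d"
          have "\<bar>lam * ?s\<bar> = lam * \<bar>?s\<bar>" using lam by (simp add: abs_mult)
          also have "\<dots> \<le> lam * (4 * \<sigma>)" using elim lam by (intro mult_left_mono) auto
          finally have ls: "\<bar>lam * ?s\<bar> \<le> 4 * \<rho>" by (simp add: \<rho>_def)
          note e = exp_minus_one_bounds[OF this]
          show ?case
          proof (cases "0 \<le> ?s")
            case True
            then have "0 \<le> lam * ?s" using lam by simp
            then have "exp (lam * ?s) - 1 \<le> exp (4 * \<rho>) * (lam * ?s)"
              using e by (simp add: max_absorb1 max_absorb2)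
            then have 1: "?d * (exp (lam * ?s) - 1) \<le> ?d * (exp (4 * \<rho>) * (lam * ?s))"
              by (intro mult_left_mono) auto
            have 2: "?s * exp (lam * ?s) \<le> ?s * exp (4 * \<rho>)" using True ls by (intro mult_left_mono) auto
            have "?h p = ?s * exp (lam * ?s) + ?d * (exp (lam * ?s) - 1)" by (simp add: algebra_simps)
            also have "\<dots> \<le> ?s * exp (4 * \<rho>) + ?d * (exp (4 * \<rho>) * (lam * ?s))" using 1 2 by linarith
            also have "\<dots> = (1 + lam * ?d) * (exp (4 * \<rho>) * max 0 ?s - ?D * max 0 (- ?s))"
              using True by (simp add: algebra_simps)
            finally show ?thesis .
          next
            case False
            \<comment> \<open>\<open>b\<close> is the decrease of distance. It is at most
              \<open>?d\<close>, because the coupled distance is nonnegative, and this keeps the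
              factor \<open>?d - b\<close> nonnegative.\<close>
            define b where "b = - ?s"
            have lb: "lam * ?s = - (lam * b)" by (simp add: b_def algebra_simps)
            then have "lam * b \<le> 4 * \<rho>" using ls by linarith
            then have b: "0 \<le> b" "b \<le> ?d" "lam * b \<le> 4 * \<rho>" "0 \<le> lam * b"
              using False lam by (auto simp: b_def)
            have "exp (lam * ?s) - 1 \<le> - ((1 - 2 * \<rho>) * (lam * b))"
              using e b(4) unfolding lb by (simp add: max_absorb1 max_absorb2)
            then have "(?d - b) * (exp (lam * ?s) - 1) \<le> (?d - b) * - ((1 - 2 * \<rho>) * (lam * b))"
              using b by (intro mult_left_mono) auto
            moreover have "?h p = (?d - b) * (exp (lam * ?s) - 1) - b" by (simp add: b_def algebra_simps)
            ultimately have "?h p \<le> - b * (1 + (?d - b) * lam * (1 - 2 * \<rho>))" by (simp add: algebra_simps)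
            also have "\<dots> \<le> - b * ((1 + lam * ?d) * ?D)"
            proof (intro mult_left_mono_neg)
              have "lam * b * (1 - 2 * \<rho>) \<le> 4 * \<rho> * 1"
                by (rule mult_mono) (use b \<rho> in auto)
              moreover have "0 \<le> lam * ?d * \<rho>" using lam \<rho> by (intro mult_nonneg_nonneg) auto
              moreover have "1 + (?d - b) * lam * (1 - 2 * \<rho>) - (1 + lam * ?d) * ?D
                  = 4 * \<rho> - lam * b * (1 - 2 * \<rho>) + 2 * (lam * ?d * \<rho>)"
                by (simp add: algebra_simps)
              ultimately show "(1 + lam * ?d) * ?D \<le> 1 + (?d - b) * lam * (1 - 2 * \<rho>)" by linarith
            qed (use b in auto)
            also have "\<dots> = (1 + lam * ?d) * (exp (4 * \<rho>) * max 0 ?s - ?D * max 0 (- ?s))"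
              using False by (simp add: b_def algebra_simps)
            finally show ?thesis .
          qed
        qed
        have "1 \<le> exp (4 * \<rho>) * exp (4 * \<rho>)" using \<rho>(1) by (simp flip: exp_add)
        then show "?D \<le> exp (4 * \<rho>) * exp (4 * \<rho>)" using \<rho>(1) by linarith
      qed (use lam \<rho> U shift_mean[OF False] unstable_near[OF False near] in auto)
      also have "\<dots> \<le> - (1 * (g * ?k * (1 / 2 + 4 / 3 * \<rho> + \<rho>)))"
      proof -
        \<comment> \<open>The constant 1/24 enters here: the gap between the slopes is 12 \<rho> to
          first order, and U \<rho> \<le> 1/24 - \<rho>, so instability consumes at most 12/24 = 1/2
          of the gain. The negative terms in \<rho> that remain cover the higher orders and the
          margin for the weight.\<close>
        have "exp (8 * \<rho>) \<le> 1 + 8 * \<rho> + (8 * \<rho>)\<^sup>2" using \<rho> by (intro exp_le_quadratic) auto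
        then have "exp (8 * \<rho>) - ?D \<le> \<rho> * (12 + 64 * \<rho>)" by (simp add: power2_eq_square algebra_simps)
        then have "U * (exp (8 * \<rho>) - ?D) \<le> U * (\<rho> * (12 + 64 * \<rho>))" using U by (intro mult_left_mono) auto
        also have "\<dots> = (\<rho> * (1 + U) - \<rho>) * (12 + 64 * \<rho>)" by (simp add: algebra_simps)
        also have "\<dots> \<le> (1 / 24 - \<rho>) * (12 + 64 * \<rho>)" using \<rho> by (intro mult_right_mono) auto
        also have "\<dots> = 1 / 2 + (64 / 24 - 12) * \<rho> - 64 * (\<rho> * \<rho>)" by (simp add: algebra_simps)
        also have "\<dots> \<le> 1 / 2 + (64 / 24 - 12) * \<rho>" by simp
        finally have D: "1 / 2 + 4 / 3 * \<rho> + \<rho> \<le> ?D - U * (exp (4 * \<rho>) * exp (4 * \<rho>) - ?D)"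
          using \<rho>(1) by (simp flip: exp_add)
        \<comment> \<open>The factor \<open>1 + lam * ?d\<close> is simply bounded below by
          1.\<close>
        have "1 * (g * ?k * (1 / 2 + 4 / 3 * \<rho> + \<rho>))
          \<le> (1 + lam * ?d) * (g * ?k * (?D - U * (exp (4 * \<rho>) * exp (4 * \<rho>) - ?D)))"
          using D k g(1) lam \<rho>(1) by (intro mult_mono mult_nonneg_nonneg) auto
        then show ?thesis by (simp add: mult.assoc)
      qed
      finally show ?thesis by simp
    qed
    also have "\<dots> \<le> - (avg m F x * ?k / 2)"
    proof -
      have "avg m F x \<le> (1 + 4 * \<rho> + 2/3 * \<rho>) * g"
        by (rule order_trans[OF Fg mult_right_mono[OF e4 g(1)]])
      then have "avg m F x * ?k \<le> (1 + 4 * \<rho> + 2/3 * \<rho>) * g * ?k" using k by (rule mult_right_mono)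
      moreover have "(1 + 4 * \<rho> + 2/3 * \<rho>) * g * ?k = 2 * (g * ?k * (1 / 2 + 4 / 3 * \<rho> + \<rho>))"
        by (simp add: field_simps)
      moreover have "- b \<le> - (a / 2)" if "a \<le> c" "c = 2 * b" for a b c :: real using that by simp
      ultimately show ?thesis by blast
    qed
    also have "\<dots> \<le> - (avg m F x * (\<kappa> * ?d) / 2)"
      using k\<kappa> nn avg_slowly_varying[OF F]
      by (intro le_imp_neg_le divide_right_mono mult_left_mono) (auto simp: slowly_varying_def)
    finally have *: "(\<integral>p. F (fst p) * ?\<phi> p \<partial>\<xi> x y) \<le> ?d * ((1 - \<kappa> / 2) * avg m F x)"
      using heq by (simp add: algebra_simps)
    have "\<bar>avg m f x - avg m f y\<bar> = \<bar>\<integral>p. f (fst p) - f (snd p) \<partial>\<xi> x y\<bar>"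
      using integral_fst[OF False tf] integral_snd[OF False tf] by simp
    also have "\<dots> \<le> (\<integral>p. \<bar>f (fst p) - f (snd p)\<bar> \<partial>\<xi> x y)" by (rule integral_abs_bound)
    also have "\<dots> \<le> (\<integral>p. exp (lam * ?d) * (F (fst p) * ?\<phi> p) \<partial>\<xi> x y)"
    proof (intro integral_mono integrable_mult_right iexp integrable_abs Bochner_Integration.integrable_diff
        integral_fst[OF False tf] integral_snd[OF False tf])
      fix p
      have "\<bar>f (fst p) - f (snd p)\<bar> \<le> ?Z p * exp (lam * ?Z p) * F (fst p)"
        using f by (auto simp: gradient_bound_def)
      also have "\<dots> = exp (lam * ?d) * (F (fst p) * ?\<phi> p)"
        by (simp add: right_diff_distrib exp_diff)
      finally show "\<bar>f (fst p) - f (snd p)\<bar> \<le> exp (lam * ?d) * (F (fst p) * ?\<phi> p)" .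
    qed
    also have "\<dots> = exp (lam * ?d) * (\<integral>p. F (fst p) * ?\<phi> p \<partial>\<xi> x y)" by simp
    also have "\<dots> \<le> exp (lam * ?d) * (?d * ((1 - \<kappa> / 2) * avg m F x))"
      using * by (intro mult_left_mono) auto
    finally show ?thesis by (simp add: algebra_simps)
  qed simp
qed

end

subsection \<open>Local variances\<close>

text \<open>This is the quantity sigma(x)^2 / n_x of the theorem; \<open>spread_local_dim\<close>
  translates back to the form with spread and local dimension.\<close>

definition max_variance :: "('a::polish_space \<Rightarrow> 'a measure) \<Rightarrow> 'a \<Rightarrow> ennreal" where
  "max_variance m x = (SUP f\<in>{f. 1-lipschitz_on UNIV f}. evariance (m x) f)"

text \<open>McShane's extension, the infimum of the cones above the graph. It is used because the
  iterates of \<open>f\<close> have a Lipschitz constant only on a support, whereas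
  \<open>max_variance\<close> ranges over globally Lipschitz functions.\<close>

lemma lipschitz_extension_real:
  fixes g :: "'a::metric_space \<Rightarrow> real"
  assumes g: "L-lipschitz_on S g" and S: "S \<noteq> {}"
  shows "\<exists>h. L-lipschitz_on UNIV h \<and> (\<forall>z\<in>S. h z = g z)"
proof (intro exI conjI ballI)
  let ?h = "\<lambda>y. INF z\<in>S. g z + L * dist y z"
  have L: "0 \<le> L" using g by (rule lipschitz_on_nonneg)
  have lip: "g z \<le> g w + L * dist z w" if "z \<in> S" "w \<in> S" for z w
    using lipschitz_onD[OF g that] by (auto simp: dist_real_def abs_le_iff)
  obtain w0 where w0: "w0 \<in> S" using S by blast
  have bb: "bdd_below ((\<lambda>z. g z + L * dist y z) ` S)" for y
  proof (rule bdd_belowI2)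
    fix z assume z: "z \<in> S"
    have "L * dist w0 z \<le> L * (dist w0 y + dist y z)"
      using L by (intro mult_left_mono dist_triangle) auto
    then show "g w0 - L * dist w0 y \<le> g z + L * dist y z"
      using lip[OF w0 z] by (simp add: algebra_simps)
  qed
  have le: "?h y \<le> ?h y' + L * dist y y'" for y y'
  proof -
    have "?h y - L * dist y y' \<le> ?h y'"
    proof (rule cINF_greatest[OF S])
      fix z assume z: "z \<in> S"
      have "?h y \<le> g z + L * dist y z" by (rule cINF_lower[OF bb z])
      also have "\<dots> \<le> g z + L * (dist y y' + dist y' z)"
        using L by (intro add_left_mono mult_left_mono dist_triangle) auto
      finally show "?h y - L * dist y y' \<le> g z + L * dist y' z" by (simp add: algebra_simps)
    qed
    then show ?thesis by simp
  qed
  show "L-lipschitz_on UNIV ?h"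
  proof (rule lipschitz_onI)
    fix y y'
    show "dist (?h y) (?h y') \<le> L * dist y y'"
      using le[of y y'] le[of y' y] by (simp add: dist_real_def abs_le_iff dist_commute)
  qed (rule L)
  fix z assume z: "z \<in> S"
  show "?h z = g z"
  proof (rule antisym)
    show "?h z \<le> g z" using cINF_lower[OF bb z, of z] by simp
    show "g z \<le> ?h z" using lip[OF z] by (intro cINF_greatest S) auto
  qed
qed

lemma lipschitz_isCont:
  assumes "L-lipschitz_on UNIV (g :: 'a::metric_space \<Rightarrow> real)"
  shows "isCont g z"
  using lipschitz_on_continuous_on[OF assms] by (simp add: continuous_on_eq_continuous_at)

lemma lipschitz_tame:
  fixes g :: "'a::metric_space \<Rightarrow> real"
  assumes "L-lipschitz_on UNIV g"
  shows "tame g"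
  unfolding tame_def
proof (intro conjI allI impI)
  show "g \<in> borel_measurable borel"
    by (intro continuous_imp_tame_measurable lipschitz_isCont[OF assms])
  fix S :: "'a set" assume "bounded S"
  then obtain o' e where S: "\<And>y. y \<in> S \<Longrightarrow> dist o' y \<le> e" by (auto simp: bounded_def)
  show "bounded (g ` S)"
    unfolding bounded_def
  proof (rule exI[of _ "g o'"], rule exI[of _ "L * e"], rule ballI)
    fix u assume "u \<in> g ` S"
    then obtain y where y: "y \<in> S" "u = g y" by auto
    have "dist (g o') (g y) \<le> L * dist o' y" by (rule lipschitz_onD[OF assms]) auto
    also have "\<dots> \<le> L * e" by (rule mult_left_mono[OF S[OF y(1)] lipschitz_on_nonneg[OF assms]])
    finally show "dist (g o') u \<le> L * e" using y by simp
  qed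
qed

lemma evariance_bounded:
  assumes M: "prob_space M" and g: "g \<in> borel_measurable M" "AE x in M. \<bar>g x\<bar> \<le> B"
  shows "evariance M g = ennreal ((\<integral>x. (g x)\<^sup>2 \<partial>M) - (\<integral>x. g x \<partial>M)\<^sup>2)"
proof -
  interpret prob_space M by fact
  have 1: "integrable M g" by (rule integrable_AE_bounded[OF M g])
  have 2: "integrable M (\<lambda>x. (g x)\<^sup>2)"
  proof (rule integrable_AE_bounded[OF M])
    show "AE x in M. \<bar>(g x)\<^sup>2\<bar> \<le> B\<^sup>2"
      using g(2) by eventually_elim (simp add: abs_le_square_iff[symmetric])
  qed (use g in measurable)
  let ?c = "\<integral>x. g x \<partial>M"
  have eq: "(\<lambda>x. (g x - ?c)\<^sup>2) = (\<lambda>x. (g x)\<^sup>2 - 2 * ?c * g x + ?c\<^sup>2)"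
    by (auto simp: power2_eq_square algebra_simps)
  have i: "integrable M (\<lambda>x. (g x - ?c)\<^sup>2)"
    unfolding eq using 1 2 by (intro Bochner_Integration.integrable_add Bochner_Integration.integrable_diff integrable_mult_right) auto
  have "(\<integral>x. (g x - ?c)\<^sup>2 \<partial>M) = (\<integral>x. (g x)\<^sup>2 \<partial>M) - 2 * ?c * ?c + ?c\<^sup>2"
    unfolding eq using 1 2 by (simp add: prob_space)
  also have "\<dots> = (\<integral>x. (g x)\<^sup>2 \<partial>M) - ?c\<^sup>2" by (simp add: power2_eq_square)
  finally show ?thesis unfolding evariance_def by (simp add: nn_integral_eq_integral[OF i])
qed

lemma evariance_cong_AE:
  assumes "f \<in> borel_measurable M" "g \<in> borel_measurable M" "AE x in M. f x = g x"
  shows "evariance M f = evariance M g"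
proof -
  have "(\<integral>x. f x \<partial>M) = (\<integral>x. g x \<partial>M)" by (rule integral_cong_AE[OF assms])
  then show ?thesis unfolding evariance_def
    by (intro nn_integral_cong_AE) (use assms(3) in \<open>auto elim!: eventually_mono\<close>)
qed

lemma evariance_cmult:
  assumes [measurable]: "g \<in> borel_measurable M"
  shows "evariance M (\<lambda>x. c * g x) = ennreal (c\<^sup>2) * evariance M g"
proof -
  have "ennreal ((c * g x - c * a)\<^sup>2) = ennreal (c\<^sup>2) * ennreal ((g x - a)\<^sup>2)" for x a
    by (simp add: power_mult_distrib flip: ennreal_mult right_diff_distrib)
  then show ?thesis
    unfolding evariance_def by (simp add: nn_integral_cmult)
qed

context bounded_walk
begin

lemma tame_measurable: "tame g \<Longrightarrow> g \<in> borel_measurable (m x)"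
  by (simp add: tame_def measurable_cong_sets[OF sets_m refl])

lemma evariance_avg:
  assumes "tame g"
  shows "evariance (m x) g = ennreal (avg m (\<lambda>y. (g y)\<^sup>2) x - (avg m g x)\<^sup>2)"
proof -
  obtain B where "\<And>y. y \<in> supp (m x) \<Longrightarrow> \<bar>g y\<bar> \<le> B"
    using tameD[OF assms bounded_supp] by metis
  then have "AE y in m x. \<bar>g y\<bar> \<le> B" using AE_m_supp[of x] by (auto elim!: eventually_mono)
  then show ?thesis unfolding avg_def by (intro evariance_bounded prob tame_measurable assms)
qed

lemma evariance_lipschitz_supp:
  assumes g: "tame g" and L: "L-lipschitz_on (supp (m x)) g"
  shows "evariance (m x) g \<le> ennreal (L\<^sup>2) * max_variance m x"
proof -
  obtain h where h: "L-lipschitz_on UNIV h" "\<And>z. z \<in> supp (m x) \<Longrightarrow> h z = g z"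
    using lipschitz_extension_real[OF L] supp_nonempty[of x] by auto
  have L0: "0 \<le> L" using L by (rule lipschitz_on_nonneg)
  have th: "tame h" by (rule lipschitz_tame[OF h(1)])
  have "evariance (m x) g = evariance (m x) h"
    using AE_m_supp[of x] h(2)
    by (intro evariance_cong_AE tame_measurable g th) (auto elim!: eventually_mono)
  also have "\<dots> \<le> ennreal (L\<^sup>2) * max_variance m x"
  proof (cases "L = 0")
    \<comment> \<open>For L = 0 the function cannot be rescaled by 1/L, but its extension is
      constant and has variance 0.\<close>
    case True
    then have "h y = h z" for y z using lipschitz_onD[OF h(1), of y z] by simp
    then have "h = (\<lambda>_. h undefined)" by blast
    moreover have "evariance (m x) (\<lambda>_. c) = 0" for c
      using prob_space.prob_space[OF prob, of x] by (simp add: evariance_def)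
    ultimately show ?thesis by (metis zero_le)
  next
    case False
    let ?h = "\<lambda>y. h y / L"
    have lip: "1-lipschitz_on UNIV ?h"
    proof (rule lipschitz_onI)
      fix y z
      have "dist (h y) (h z) \<le> L * dist y z" by (rule lipschitz_onD[OF h(1)]) auto
      then show "dist (h y / L) (h z / L) \<le> 1 * dist y z"
        using False L0 by (simp add: dist_real_def divide_simps mult.commute flip: diff_divide_distrib)
    qed simp
    have "evariance (m x) h = evariance (m x) (\<lambda>y. L * ?h y)" using False by simp
    also have "\<dots> = ennreal (L\<^sup>2) * evariance (m x) ?h"
      by (rule evariance_cmult[OF tame_measurable[OF lipschitz_tame[OF lip]]])
    also have "\<dots> \<le> ennreal (L\<^sup>2) * max_variance m x"
      unfolding max_variance_def using lip by (intro mult_left_mono SUP_upper) auto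
    finally show ?thesis .
  qed
  finally show ?thesis .
qed

end

context contracting_walk
begin

definition \<theta> :: real where "\<theta> = 1 - \<kappa> / 2"

lemma \<theta>: "0 \<le> \<theta>" "0 < \<theta>" "\<theta> < 1"
  using \<kappa> by (auto simp: \<theta>_def)

lemma slowly_varying_cmult: "slowly_varying lam F \<Longrightarrow> 0 \<le> c \<Longrightarrow> slowly_varying lam (\<lambda>x. c * F x)"
  unfolding slowly_varying_def
  by (auto simp: mult.left_commute intro!: mult_left_mono)

lemma avg_cmult: "avg m (\<lambda>x. c * g x) = (\<lambda>x. c * avg m g x)"
  by (auto simp: avg_def)

lemma iterate_slowly_varying: "slowly_varying lam F \<Longrightarrow> slowly_varying lam ((avg m ^^ t) F)"
  by (induction t) (auto intro: avg_slowly_varying)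

lemma iterate_gradient_bound:
  assumes "gradient_bound lam f F" "slowly_varying lam F"
  shows "gradient_bound lam ((avg m ^^ t) f) (\<lambda>x. \<theta> ^ t * (avg m ^^ t) F x)"
proof (induction t)
  case (Suc t)
  have "slowly_varying lam (\<lambda>x. \<theta> ^ t * (avg m ^^ t) F x)"
    using \<theta> by (intro slowly_varying_cmult iterate_slowly_varying assms) auto
  from avg_gradient_bound[OF Suc this] show ?case
    by (simp add: avg_cmult \<theta>_def mult.assoc)
qed (use assms in simp)

text \<open>On the support the weight is at most \<open>exp (4 * \<rho>)\<close> times its own
  average, and distances of at most \<open>2 * \<sigma>\<close> add the factor
  \<open>exp (2 * \<rho>)\<close>. So the t-th iterate of \<open>f\<close> is Lipschitz there with
  constant \<open>\<theta> ^ t * exp (6 * \<rho>)\<close> times the average.\<close>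

lemma evariance_iterate:
  assumes f: "gradient_bound lam f F" and F: "slowly_varying lam F"
  shows "evariance (m x) ((avg m ^^ t) f)
    \<le> ennreal (2 * \<theta> ^ (2 * t) * ((avg m ^^ Suc t) F x)\<^sup>2) * max_variance m x"
proof -
  let ?f = "(avg m ^^ t) f" and ?F = "(avg m ^^ t) F" and ?G = "(avg m ^^ Suc t) F"
  have gb: "gradient_bound lam ?f (\<lambda>x. \<theta> ^ t * ?F x)" by (rule iterate_gradient_bound[OF f F])
  have sv: "slowly_varying lam ?F" "slowly_varying lam ?G" by (rule iterate_slowly_varying[OF F])+
  have nn: "0 \<le> ?F z" "0 \<le> ?G z" for z using sv by (simp_all add: slowly_varying_def)
  obtain g where g: "0 \<le> g" "\<And>z. z \<in> supp (m x) \<Longrightarrow> g \<le> ?F z \<and> ?F z \<le> exp (4 * (lam * \<sigma>)) * g"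
    using slowly_varying_supp[OF sv(1) less_imp_le[OF lam], of x] by blast
  have "avg m (\<lambda>_. g) x \<le> avg m ?F x"
    using g(2) lam by (intro avg_mono tame_const slowly_varying_tame[OF sv(1)]) auto
  then have gG: "g \<le> ?G x" by simp
  let ?L = "\<theta> ^ t * exp (6 * \<rho>) * ?G x"
  have "?L-lipschitz_on (supp (m x)) ?f"
  proof (rule lipschitz_onI)
    fix z z' assume z: "z \<in> supp (m x)" "z' \<in> supp (m x)"
    have "\<bar>?f z - ?f z'\<bar> \<le> dist z z' * exp (lam * dist z z') * (\<theta> ^ t * ?F z)"
      using gb by (simp add: gradient_bound_def)
    also have "\<dots> \<le> dist z z' * exp (2 * \<rho>) * (\<theta> ^ t * (exp (4 * \<rho>) * ?G x))"
    proof (intro mult_mono mult_nonneg_nonneg)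
      show "exp (lam * dist z z') \<le> exp (2 * \<rho>)"
        using mult_left_mono[OF supp_dist[OF z] less_imp_le[OF lam]] by (simp add: \<rho>_def)
      show "?F z \<le> exp (4 * \<rho>) * ?G x"
        using order_trans[OF conjunct2[OF g(2)[OF z(1)]] mult_left_mono[OF gG]] by (simp add: \<rho>_def)
    qed (use \<theta> nn in auto)
    also have "\<dots> = ?L * dist z z'"
      by (simp add: mult_ac mult_exp_exp)
    finally show "dist (?f z) (?f z') \<le> ?L * dist z z'" by (simp add: dist_real_def)
  qed (use \<theta> nn in \<open>auto intro!: mult_nonneg_nonneg\<close>)
  moreover have "tame ?f"
  proof (rule gradient_bound_tame[OF gb])
    show "slowly_varying lam (\<lambda>x. \<theta> ^ t * ?F x)" using \<theta> by (intro slowly_varying_cmult sv) auto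
  qed (use lam in simp)
  ultimately have "evariance (m x) ?f \<le> ennreal (?L\<^sup>2) * max_variance m x"
    by (intro evariance_lipschitz_supp)
  also have "\<dots> \<le> ennreal (2 * \<theta> ^ (2 * t) * (?G x)\<^sup>2) * max_variance m x"
  proof (intro mult_right_mono ennreal_leI)
    \<comment> \<open>Since 12 \<rho> \<le> 1/2, the squared factor is at most 1 + 1/2 + 1/4 < 2.
      This is the leading 2 of \<open>local_weight\<close>.\<close>
    have "exp (12 * \<rho>) \<le> 1 + 12 * \<rho> + (12 * \<rho>)\<^sup>2" using \<rho> by (intro exp_le_quadratic) auto
    also have "(12 * \<rho>)\<^sup>2 \<le> (1 / 2)\<^sup>2" using \<rho> by (intro power_mono) auto
    also have "1 + 12 * \<rho> + (1 / 2)\<^sup>2 \<le> 2" using \<rho> by (simp add: power2_eq_square)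
    finally have e: "exp (12 * \<rho>) \<le> 2" by simp
    have "?L\<^sup>2 = exp (12 * \<rho>) * (\<theta> ^ (2 * t) * (?G x)\<^sup>2)"
      by (simp add: power_mult_distrib power_mult[symmetric] mult.commute flip: exp_double)
    also have "\<dots> \<le> 2 * (\<theta> ^ (2 * t) * (?G x)\<^sup>2)"
      using e \<theta> by (intro mult_right_mono) auto
    finally show "?L\<^sup>2 \<le> 2 * \<theta> ^ (2 * t) * (?G x)\<^sup>2" by (simp add: mult.assoc)
  qed simp
  finally show ?thesis .
qed

section \<open>Growth of supports and stability of tame functions under averaging\<close>

text \<open>Contraction bounds the mean coupled distance between \<open>m x\<close> and
  \<open>m o'\<close> by (1 - \<kappa>) d(x, o'). Any two support points are at most
  \<open>4 * \<sigma>\<close> farther apart than this mean, so the bound on the mean turns into one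
  that holds at every support point.\<close>

lemma supp_dist_growth:
  "\<exists>J\<ge>0. \<forall>x. \<forall>z\<in>supp (m x). dist o' z \<le> (1 - \<kappa>) * dist o' x + J"
proof -
  have "bounded (insert o' (supp (m o')))" by (simp add: bounded_supp)
  then have "\<exists>J. \<forall>w\<in>insert o' (supp (m o')). dist o' w \<le> J"
    by (simp only: bounded_any_center[of _ o'])
  then obtain J where J: "\<And>w. w \<in> insert o' (supp (m o')) \<Longrightarrow> dist o' w \<le> J"
    by (elim exE, metis)
  have J0: "0 \<le> J" using J[of o'] by simp
  show ?thesis
  proof (intro exI[of _ "J + 4 * \<sigma>"] conjI allI ballI)
    show "0 \<le> J + 4 * \<sigma>" using J0 sigma_nonneg by simp
    fix x z assume z: "z \<in> supp (m x)"
    show "dist o' z \<le> (1 - \<kappa>) * dist o' x + (J + 4 * \<sigma>)"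
    proof (cases "x = o'")
      case True
      then show ?thesis using z J[of z] sigma_nonneg by simp
    next
      case False
      interpret \<xi>: prob_space "\<xi> x o'" by (rule prob_\<xi>[OF False])
      obtain w where w: "w \<in> supp (m o')" using supp_nonempty by blast
      have "dist z w - 4 * \<sigma> \<le> (\<integral>p. dist (fst p) (snd p) \<partial>\<xi> x o')"
      proof (rule \<xi>.integral_ge_const)
        show "integrable (\<xi> x o') (\<lambda>p. dist (fst p) (snd p))"
          by (rule integrable_dist_\<xi>[OF False, where \<phi> = "\<lambda>t. t"]) (intro continuous_intros)
        show "AE p in \<xi> x o'. dist z w - 4 * \<sigma> \<le> dist (fst p) (snd p)"
          using AE_\<xi>[OF False]
        proof eventually_elim
          case (elim p)
          then show ?case using dist_supp_close[OF z w, of "fst p" "snd p"] by linarith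
        qed
      qed
      also have "\<dots> \<le> (1 - \<kappa>) * dist x o'" by (rule contraction[OF False])
      finally show ?thesis
        using J[of w] w dist_triangle[of o' z w] by (simp add: dist_commute)
    qed
  qed
qed

text \<open>By \<open>supp_dist_growth\<close> the supports of \<open>m x\<close> for
  \<open>x\<close> in a bounded set have a bounded union, so one bound on \<open>g\<close> serves
  all of them.\<close>

lemma tame_avg:
  assumes "tame g"
  shows "tame (avg m g)"
  unfolding tame_def
proof (intro conjI allI impI measurable_avg assms)
  fix S :: "'a set" assume "bounded S"
  then obtain o' e where S: "\<And>y. y \<in> S \<Longrightarrow> dist o' y \<le> e" by (auto simp: bounded_def)
  obtain J where J: "\<And>x z. z \<in> supp (m x) \<Longrightarrow> dist o' z \<le> (1 - \<kappa>) * dist o' x + J"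
    using supp_dist_growth by blast
  have b: "bounded (\<Union>x\<in>S. supp (m x))"
    unfolding bounded_def
  proof (intro exI[of _ o'] exI[of _ "(1 - \<kappa>) * e + J"] ballI)
    fix z assume "z \<in> (\<Union>x\<in>S. supp (m x))"
    then obtain x where x: "x \<in> S" "z \<in> supp (m x)" by blast
    have "(1 - \<kappa>) * dist o' x \<le> (1 - \<kappa>) * e" using S[OF x(1)] \<kappa> by (intro mult_left_mono) auto
    then show "dist o' z \<le> (1 - \<kappa>) * e + J" using J[OF x(2)] by simp
  qed
  obtain B where B: "\<And>y. y \<in> (\<Union>x\<in>S. supp (m x)) \<Longrightarrow> \<bar>g y\<bar> \<le> B" using tameD[OF assms b] by metis
  have ag: "tame (\<lambda>y. \<bar>g y\<bar>)"
    unfolding tame_def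
  proof (intro conjI allI impI)
    fix T :: "'a set" assume "bounded T"
    then obtain B where "\<And>x. x \<in> T \<Longrightarrow> \<bar>g x\<bar> \<le> B" using tameD[OF assms] by metis
    then show "bounded ((\<lambda>y. \<bar>g y\<bar>) ` T)" by (auto simp: bounded_iff)
  qed (use assms in \<open>auto simp: tame_def\<close>)
  have "\<bar>avg m g x\<bar> \<le> B" if x: "x \<in> S" for x
  proof -
    have "\<bar>avg m g x\<bar> \<le> avg m (\<lambda>y. \<bar>g y\<bar>) x" unfolding avg_def by (rule integral_abs_bound)
    also have "\<dots> \<le> avg m (\<lambda>_. B) x" using B x by (intro avg_mono ag tame_const) auto
    finally show ?thesis by simp
  qed
  then show "bounded (avg m g ` S)" by (auto simp: bounded_iff)
qed

lemma tame_iterate: "tame g \<Longrightarrow> tame ((avg m ^^ t) g)"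
  by (induction t) (auto intro: tame_avg)

end

subsection \<open>Measurability and invariance\<close>

lemma lipschitz_Min:
  fixes F :: "(real \<times> 'a::metric_space) set"
  assumes "finite F" "F \<noteq> {}"
  shows "1-lipschitz_on UNIV (\<lambda>y. Min ((\<lambda>(q, z). q + dist y z) ` F))"
proof (rule lipschitz_onI)
  let ?h = "\<lambda>y. Min ((\<lambda>(q, z). q + dist y z) ` F)"
  have le: "?h y \<le> ?h y' + dist y y'" for y y'
  proof -
    have "?h y' \<in> (\<lambda>(q, z). q + dist y' z) ` F" using assms by (intro Min_in) auto
    then obtain q z where qz: "(q, z) \<in> F" "?h y' = q + dist y' z" by auto
    have "?h y \<le> q + dist y z" using assms qz(1) by (intro Min_le) (auto intro!: image_eqI[of _ _ "(q, z)"])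
    then show ?thesis using qz(2) dist_triangle[of y z y'] by linarith
  qed
  fix y y'
  show "dist (?h y) (?h y') \<le> 1 * dist y y'"
    using le[of y y'] le[of y' y] by (simp add: dist_real_def abs_le_iff dist_commute)
qed simp

text \<open>Reduces the uncountable supremum in \<open>max_variance\<close> to a countable one. The
  family consists of finite minima of cones q + d(., z) with rational heights q and vertices z in a
  countable dense set.\<close>

lemma countable_dense_lipschitz:
  obtains H :: "('a::{second_countable_topology, metric_space} \<Rightarrow> real) set"
  where "countable H" "\<And>h. h \<in> H \<Longrightarrow> 1-lipschitz_on UNIV h"
    "\<And>g. 1-lipschitz_on UNIV g \<Longrightarrow> \<exists>h. (\<forall>n. h n \<in> H) \<and> (\<forall>y. (\<lambda>n. h n y) \<longlonglongrightarrow> g y)"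
proof -
  obtain D :: "'a set" where D: "countable D" "\<And>X. open X \<Longrightarrow> X \<noteq> {} \<Longrightarrow> \<exists>d\<in>D. d \<in> X"
    using countable_dense_setE by metis
  have D0: "D \<noteq> {}" using D(2)[of UNIV] by auto
  define \<F> where "\<F> = {F. F \<subseteq> (\<rat> :: real set) \<times> D \<and> finite F \<and> F \<noteq> {}}"
  define e where "e = (\<lambda>F (y :: 'a). Min ((\<lambda>(q, z). q + dist y z) ` F) :: real)"
  have "countable ((\<rat> :: real set) \<times> D)" by (intro countable_SIGMA countable_rat D(1))
  then have c\<F>: "countable \<F>"
    by (rule countable_subset[OF _ countable_Collect_finite_subset, rotated]) (auto simp: \<F>_def)
  show thesis
  proof (rule that[of "e ` \<F>"])
    show "countable (e ` \<F>)" using c\<F> by simp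
    show "1-lipschitz_on UNIV h" if "h \<in> e ` \<F>" for h
      using that lipschitz_Min by (auto simp: \<F>_def e_def)
    fix g :: "'a \<Rightarrow> real" assume g: "1-lipschitz_on UNIV g"
    have lip: "g y \<le> g z + dist y z" for y z
      using lipschitz_onD[OF g, of y z] by (simp add: dist_real_def abs_le_iff)
    have "\<exists>q\<in>\<rat>. g (from_nat_into D i) < q \<and> q < g (from_nat_into D i) + 1 / (real n + 1)" for i n
      by (rule Rats_dense_in_real) simp
    then obtain q where q: "\<And>i n. q i n \<in> \<rat>" "\<And>i n. g (from_nat_into D i) < q i n"
      "\<And>i n. q i n < g (from_nat_into D i) + 1 / (real n + 1)" by metis
    define F where "F n = (\<lambda>i. (q i n, from_nat_into D i)) ` {..n}" for n
    have F: "F n \<in> \<F>" for n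
      using q(1) from_nat_into[OF D0] by (auto simp: F_def \<F>_def)
    have fin: "finite ((\<lambda>(q, z). q + dist y z) ` F n)" "(\<lambda>(q, z). q + dist y z) ` F n \<noteq> {}" for y n
      by (auto simp: F_def)
    show "\<exists>h. (\<forall>n. h n \<in> e ` \<F>) \<and> (\<forall>y. (\<lambda>n. h n y) \<longlonglongrightarrow> g y)"
    proof (intro exI[of _ "\<lambda>n. e (F n)"] conjI allI)
      show "e (F n) \<in> e ` \<F>" for n using F by blast
      fix y
      have lower: "g y \<le> e (F n) y" for n
        unfolding e_def
      proof (rule Min.boundedI[OF fin])
        fix a assume "a \<in> (\<lambda>(q, z). q + dist y z) ` F n"
        then obtain i where "a = q i n + dist y (from_nat_into D i)" by (auto simp: F_def)
        then show "g y \<le> a" using lip[of y "from_nat_into D i"] q(2)[of i n] by linarith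
      qed
      have upper: "e (F n) y \<le> g y + 2 * dist y (from_nat_into D i) + 1 / (real n + 1)" if "i \<le> n" for i n
      proof -
        have "e (F n) y \<le> q i n + dist y (from_nat_into D i)"
          unfolding e_def using that by (intro Min_le fin) (auto simp: F_def image_image)
        then show ?thesis
          using q(3)[of i n] lip[of "from_nat_into D i" y] by (simp add: dist_commute)
      qed
      show "(\<lambda>n. e (F n) y) \<longlonglongrightarrow> g y"
      proof (rule LIMSEQ_I)
        fix r :: real assume r: "0 < r"
        obtain d where d: "d \<in> D" "d \<in> ball y (r / 4)" using D(2)[of "ball y (r / 4)"] r by auto
        obtain i where i: "d = from_nat_into D i" using d(1) D(1) from_nat_into_surj by metis
        obtain N where N: "1 / (real N + 1) < r / 2"
          using reals_Archimedean[of "r / 2"] r by (auto simp: inverse_eq_divide add.commute)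
        show "\<exists>no. \<forall>n\<ge>no. norm (e (F n) y - g y) < r"
        proof (intro exI[of _ "max i N"] allI impI)
          fix n assume n: "max i N \<le> n"
          have "1 / (real n + 1) \<le> 1 / (real N + 1)" using n by (intro divide_left_mono) auto
          then show "norm (e (F n) y - g y) < r"
            using lower[of n] upper[of i n] n N d(2) i by simp
        qed
      qed
    qed
  qed
qed

lemma borel_measurable_averaging:
  assumes "m \<in> borel \<rightarrow>\<^sub>M subprob_algebra borel" "h \<in> borel_measurable borel"
  shows "averaging m h \<in> borel_measurable borel"
  unfolding averaging_def
proof (rule nn_integral_measurable_subprob_algebra2[OF _ assms(1)])
  note assms(2)[measurable]
  show "(\<lambda>(x, y). h y) \<in> borel_measurable (borel \<Otimes>\<^sub>M borel)" by measurable
qed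

lemma borel_measurable_averaging_iterate:
  assumes "m \<in> borel \<rightarrow>\<^sub>M subprob_algebra borel" "h \<in> borel_measurable borel"
  shows "(averaging m ^^ n) h \<in> borel_measurable borel"
  by (induction n) (auto intro: assms borel_measurable_averaging)

context bounded_walk
begin

lemma evariance_le_SUP_of_pointwise_limit:
  assumes h: "\<And>n. 1-lipschitz_on UNIV (h n)" and g: "1-lipschitz_on UNIV g"
    and lim: "\<And>y. (\<lambda>n. h n y) \<longlonglongrightarrow> g y"
  shows "evariance (m x) g \<le> (SUP n. evariance (m x) (h n))"
proof -
  obtain y0 where y0: "y0 \<in> supp (m x)" using supp_nonempty by blast
  obtain B where B: "\<And>n. \<bar>h n y0\<bar> \<le> B"
    using convergent_imp_Bseq[OF convergentI[OF lim[of y0]]] by (auto simp: Bseq_def)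
  have bound: "\<bar>h n y\<bar> \<le> B + 2 * \<sigma>" if "y \<in> supp (m x)" for n y
    using lipschitz_onD[OF h, of y y0 n] supp_dist[OF that y0] B[of n] by (simp add: dist_real_def)
  have th: "tame (h n)" "tame g" for n using h g by (auto intro: lipschitz_tame)
  have c: "integrable (m x) (\<lambda>_. c :: real)" for c using tame_integrable[OF tame_const] .
  have sq: "(\<lambda>y. (h n y)\<^sup>2) \<in> borel_measurable (m x)" "(\<lambda>y. (g y)\<^sup>2) \<in> borel_measurable (m x)" for n
    using tame_measurable[OF th(1)[of n]] tame_measurable[OF th(2)] by measurable
  have 1: "(\<lambda>n. avg m (h n) x) \<longlonglongrightarrow> avg m g x"
    unfolding avg_def
  proof (rule integral_dominated_convergence[where w = "\<lambda>_. B + 2 * \<sigma>"])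
    show "AE y in m x. norm (h n y) \<le> B + 2 * \<sigma>" for n
      using AE_m_supp[of x] by eventually_elim (use bound in auto)
  qed (use th tame_measurable c lim in auto)
  have 2: "(\<lambda>n. avg m (\<lambda>y. (h n y)\<^sup>2) x) \<longlonglongrightarrow> avg m (\<lambda>y. (g y)\<^sup>2) x"
    unfolding avg_def
  proof (rule integral_dominated_convergence[where w = "\<lambda>_. (B + 2 * \<sigma>)\<^sup>2"])
    show "AE y in m x. norm ((h n y)\<^sup>2) \<le> (B + 2 * \<sigma>)\<^sup>2" for n
      using AE_m_supp[of x]
    proof eventually_elim
      case (elim y)
      then have "\<bar>h n y\<bar>\<^sup>2 \<le> (B + 2 * \<sigma>)\<^sup>2" by (intro power_mono bound) auto
      then show ?case by simp
    qed
  qed (use sq c lim in \<open>auto intro!: tendsto_intros\<close>)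
  have "(\<lambda>n. evariance (m x) (h n)) \<longlonglongrightarrow> evariance (m x) g"
    unfolding evariance_avg[OF th(1)] evariance_avg[OF th(2)]
    by (intro tendsto_ennrealI tendsto_intros 1 2)
  then show ?thesis by (rule LIMSEQ_le_const2) (intro exI allI impI SUP_upper; simp)
qed

lemma borel_measurable_max_variance: "max_variance m \<in> borel_measurable borel"
proof -
  obtain H :: "('a \<Rightarrow> real) set" where H: "countable H" "\<And>h. h \<in> H \<Longrightarrow> 1-lipschitz_on UNIV h"
    "\<And>g. 1-lipschitz_on UNIV g \<Longrightarrow> \<exists>h. (\<forall>n. h n \<in> H) \<and> (\<forall>y. (\<lambda>n. h n y) \<longlonglongrightarrow> g y)"
    by (rule countable_dense_lipschitz) blast
  have "max_variance m x = (SUP h\<in>H. evariance (m x) h)" for x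
  proof (rule antisym)
    show "max_variance m x \<le> (SUP h\<in>H. evariance (m x) h)"
      unfolding max_variance_def
    proof (rule SUP_least)
      fix g :: "'a \<Rightarrow> real" assume "g \<in> {f. 1-lipschitz_on UNIV f}"
      then obtain h where h: "\<And>n. h n \<in> H" "\<And>y. (\<lambda>n. h n y) \<longlonglongrightarrow> g y" "1-lipschitz_on UNIV g"
        using H(3)[of g] by auto
      have "evariance (m x) g \<le> (SUP n. evariance (m x) (h n))"
        using h H(2) by (intro evariance_le_SUP_of_pointwise_limit) auto
      also have "\<dots> \<le> (SUP h\<in>H. evariance (m x) h)" using h(1) by (intro SUP_least SUP_upper)
      finally show "evariance (m x) g \<le> (SUP h\<in>H. evariance (m x) h)" .
    qed
    show "(SUP h\<in>H. evariance (m x) h) \<le> max_variance m x"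
      unfolding max_variance_def using H(2) by (intro SUP_subset_mono) auto
  qed
  then have "max_variance m = (\<lambda>x. SUP h\<in>H. evariance (m x) h)" by blast
  moreover have "(\<lambda>x. evariance (m x) h) \<in> borel_measurable borel" if "h \<in> H" for h
  proof -
    have th: "tame h" by (rule lipschitz_tame[OF H(2)[OF that]])
    have h: "h \<in> borel_measurable borel" and a: "(\<lambda>x. \<integral>z. h z \<partial>m x) \<in> borel_measurable borel"
      using th measurable_avg[OF th] by (auto simp: tame_def avg_def[abs_def])
    show ?thesis
      unfolding evariance_def
      by (rule nn_integral_measurable_subprob_algebra2[where N=borel, OF _ subprob_kernel])
        (use h a in measurable)
  qed
  ultimately show ?thesis using H(1) by (simp add: borel_measurable_SUP)
qed

lemma avg_pos:
  assumes v: "tame v" "\<And>y. 0 < v y"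
  shows "0 < avg m v x"
proof -
  interpret prob_space "m x" by (rule prob)
  have "0 \<le> avg m v x" unfolding avg_def using v(2) by (intro integral_nonneg_AE) (auto intro: less_imp_le)
  moreover have "avg m v x \<noteq> 0"
  proof
    assume "avg m v x = 0"
    then have "AE y in m x. v y = 0"
      unfolding avg_def using v tame_integrable[OF v(1), of x]
      by (subst (asm) integral_nonneg_eq_0_iff_AE) (auto intro: less_imp_le)
    then have "AE y in m x. False" by eventually_elim (use v(2) in \<open>metis less_irrefl\<close>)
    then show False by simp
  qed
  ultimately show ?thesis by simp
qed

lemma cauchy_schwarz_avg:
  assumes u: "tame u" and v: "tame v" "\<And>y. 0 < v y"
  shows "ennreal ((avg m u x)\<^sup>2 / avg m v x) \<le> averaging m (\<lambda>y. ennreal ((u y)\<^sup>2 / v y)) x"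
proof -
  define b where "b = avg m u x / avg m v x"
  have v0: "0 < avg m v x" by (rule avg_pos[OF v])
  have i: "integrable (m x) (\<lambda>y. 2 * b * u y - b\<^sup>2 * v y)"
    by (intro Bochner_Integration.integrable_diff integrable_mult_right tame_integrable u v)
  have "(\<integral>y. 2 * b * u y - b\<^sup>2 * v y \<partial>m x) = 2 * b * avg m u x - b\<^sup>2 * avg m v x"
    using tame_integrable[OF u, of x] tame_integrable[OF v(1), of x] by (simp add: avg_def)
  also have "\<dots> = (avg m u x)\<^sup>2 / avg m v x"
    using v0 by (simp add: b_def power2_eq_square field_simps)
  finally have "ennreal ((avg m u x)\<^sup>2 / avg m v x) \<le> (\<integral>\<^sup>+y. ennreal (2 * b * u y - b\<^sup>2 * v y) \<partial>m x)"
    using ennreal_integral_le_nn_integral[OF i] by simp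
  also have "\<dots> \<le> (\<integral>\<^sup>+y. ennreal ((u y)\<^sup>2 / v y) \<partial>m x)"
  proof (intro nn_integral_mono ennreal_leI)
    fix y
    have "0 \<le> (u y - b * v y)\<^sup>2 / v y" using v(2)[of y] by simp
    also have "\<dots> = (u y)\<^sup>2 / v y - (2 * b * u y - b\<^sup>2 * v y)"
      using v(2)[of y] by (simp add: power2_eq_square field_simps)
    finally show "2 * b * u y - b\<^sup>2 * v y \<le> (u y)\<^sup>2 / v y" by simp
  qed
  finally show ?thesis by (simp add: averaging_def)
qed

end

context contracting_walk
begin

lemma iterate_pos: "tame v \<Longrightarrow> (\<And>y. 0 < v y) \<Longrightarrow> 0 < (avg m ^^ n) v x"
  by (induction n arbitrary: x) (auto intro: avg_pos tame_iterate)

lemma cauchy_schwarz_iterate: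
  assumes u: "tame u" and v: "tame v" "\<And>y. 0 < v y"
  shows "ennreal (((avg m ^^ n) u x)\<^sup>2 / (avg m ^^ n) v x)
    \<le> (averaging m ^^ n) (\<lambda>y. ennreal ((u y)\<^sup>2 / v y)) x"
proof (induction n arbitrary: x)
  case (Suc n)
  have "ennreal (((avg m ^^ Suc n) u x)\<^sup>2 / (avg m ^^ Suc n) v x)
      \<le> averaging m (\<lambda>y. ennreal (((avg m ^^ n) u y)\<^sup>2 / (avg m ^^ n) v y)) x"
    using cauchy_schwarz_avg[OF tame_iterate[OF u] tame_iterate[OF v(1)] iterate_pos[OF v]] by simp
  also have "\<dots> \<le> averaging m ((averaging m ^^ n) (\<lambda>y. ennreal ((u y)\<^sup>2 / v y))) x"
    unfolding averaging_def by (intro nn_integral_mono) (rule Suc[unfolded averaging_def])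
  finally show ?case by simp
qed simp

end

locale invariant_walk = contracting_walk m \<sigma> \<xi> \<kappa> U lam
  for m :: "'a::polish_space \<Rightarrow> 'a measure" and \<sigma> \<xi> \<kappa> U lam +
  fixes \<nu> :: "'a measure"
  assumes invariant: "invariant_distribution m \<nu>"
begin

lemma prob_\<nu>: "prob_space \<nu>"
  and sets_\<nu> [measurable_cong]: "sets \<nu> = sets borel"
  and \<nu>_bind: "\<nu> \<bind> m = \<nu>"
  using invariant by (auto simp: invariant_distribution_def)

sublocale nu: prob_space \<nu> by (rule prob_\<nu>)

lemma nn_integral_averaging:
  assumes "h \<in> borel_measurable borel"
  shows "(\<integral>\<^sup>+x. averaging m h x \<partial>\<nu>) = (\<integral>\<^sup>+x. h x \<partial>\<nu>)"
proof -
  have "m \<in> \<nu> \<rightarrow>\<^sub>M subprob_algebra borel"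
    using subprob_kernel by (simp add: measurable_cong_sets[OF sets_\<nu> refl])
  from nn_integral_bind[OF assms this] show ?thesis by (simp add: \<nu>_bind averaging_def)
qed

lemma nn_integral_averaging_iterate:
  assumes h: "h \<in> borel_measurable borel"
  shows "(\<integral>\<^sup>+x. (averaging m ^^ n) h x \<partial>\<nu>) = (\<integral>\<^sup>+x. h x \<partial>\<nu>)"
proof (induction n)
  case (Suc n)
  show ?case
    using nn_integral_averaging[OF borel_measurable_averaging_iterate[OF subprob_kernel h]] Suc by simp
qed simp

text \<open>The support of \<open>m x\<close> lies within \<open>(1 - \<kappa>) d(o, x) + J\<close> of \<open>o\<close>, so the excess of \<open>d(o, x)\<close> over
  \<open>J / \<kappa>\<close> is contracted by the walk, and invariance forces it to vanish \<open>\<nu>\<close>-almost everywhere.\<close>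

lemma absorbing_set:
  obtains S where "bounded S" "\<And>x. x \<in> S \<Longrightarrow> supp (m x) \<subseteq> S" "AE x in \<nu>. x \<in> S"
proof -
  obtain o' where o': "(\<integral>\<^sup>+ y. ennreal (dist o' y) \<partial>\<nu>) < \<infinity>"
    using invariant by (auto simp: invariant_distribution_def finite_first_moment_def)
  obtain J where J: "0 \<le> J" "\<And>x z. z \<in> supp (m x) \<Longrightarrow> dist o' z \<le> (1 - \<kappa>) * dist o' x + J"
    using supp_dist_growth by blast
  define R where "R = J / \<kappa>"
  have R: "0 \<le> R" "J = \<kappa> * R" using J(1) \<kappa> by (auto simp: R_def)
  define u where "u x = max 0 (dist o' x - R)" for x
  have contr: "u z \<le> (1 - \<kappa>) * u x" if "z \<in> supp (m x)" for x z
  proof -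
    have "dist o' z - R \<le> (1 - \<kappa>) * (dist o' x - R)" using J(2)[OF that] R(2) by (simp add: algebra_simps)
    also have "\<dots> \<le> (1 - \<kappa>) * u x" using \<kappa> by (intro mult_left_mono) (auto simp: u_def)
    finally show ?thesis using \<kappa> by (auto simp: u_def)
  qed
  have um: "u \<in> borel_measurable borel" unfolding u_def by measurable
  have "(\<integral>\<^sup>+x. ennreal (u x) \<partial>\<nu>) \<le> (\<integral>\<^sup>+x. ennreal (dist o' x) \<partial>\<nu>)"
    using R(1) by (intro nn_integral_mono ennreal_leI) (auto simp: u_def)
  then have fin: "(\<integral>\<^sup>+x. ennreal (u x) \<partial>\<nu>) < \<infinity>" using o' by (rule le_less_trans)
  have "(\<integral>\<^sup>+x. ennreal (u x) \<partial>\<nu>) = (\<integral>\<^sup>+x. averaging m (\<lambda>x. ennreal (u x)) x \<partial>\<nu>)"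
    using um by (intro nn_integral_averaging[symmetric]) measurable
  also have "\<dots> \<le> (\<integral>\<^sup>+x. ennreal (1 - \<kappa>) * ennreal (u x) \<partial>\<nu>)"
  proof (rule nn_integral_mono)
    fix x
    have "averaging m (\<lambda>x. ennreal (u x)) x \<le> (\<integral>\<^sup>+y. ennreal ((1 - \<kappa>) * u x) \<partial>m x)"
      unfolding averaging_def using AE_m_supp[of x] contr
      by (intro nn_integral_mono_AE) (auto elim!: eventually_mono intro: ennreal_leI)
    also have "\<dots> = ennreal (1 - \<kappa>) * ennreal (u x)"
      using \<kappa> prob_space.emeasure_space_1[OF prob, of x] by (simp add: ennreal_mult u_def)
    finally show "averaging m (\<lambda>x. ennreal (u x)) x \<le> ennreal (1 - \<kappa>) * ennreal (u x)" .
  qed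
  also have "\<dots> = ennreal (1 - \<kappa>) * (\<integral>\<^sup>+x. ennreal (u x) \<partial>\<nu>)"
    using um by (intro nn_integral_cmult) measurable
  finally have le: "(\<integral>\<^sup>+x. ennreal (u x) \<partial>\<nu>) \<le> ennreal (1 - \<kappa>) * (\<integral>\<^sup>+x. ennreal (u x) \<partial>\<nu>)" .
  obtain I where I: "0 \<le> I" "(\<integral>\<^sup>+x. ennreal (u x) \<partial>\<nu>) = ennreal I"
    using fin by (cases "\<integral>\<^sup>+x. ennreal (u x) \<partial>\<nu>") auto
  have "I \<le> (1 - \<kappa>) * I" using le I \<kappa> by (simp flip: ennreal_mult)
  then have "I = 0" using I(1) \<kappa> by (simp add: algebra_simps mult_le_0_iff)
  then have "(\<integral>\<^sup>+x. ennreal (u x) \<partial>\<nu>) = 0" using I(2) by simp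
  moreover have "(\<lambda>x. ennreal (u x)) \<in> borel_measurable \<nu>" using um by measurable
  ultimately have "AE x in \<nu>. u x \<le> 0" by (simp add: nn_integral_0_iff_AE ennreal_eq_0_iff)
  show thesis
  proof (rule that[of "cball o' R"])
    show "AE x in \<nu>. x \<in> cball o' R"
      using \<open>AE x in \<nu>. u x \<le> 0\<close> by eventually_elim (simp add: u_def)
    show "supp (m x) \<subseteq> cball o' R" if "x \<in> cball o' R" for x
    proof
      fix z assume "z \<in> supp (m x)"
      from contr[OF this] that show "z \<in> cball o' R" by (simp add: u_def)
    qed
  qed simp
qed

lemma integrable_\<nu>:
  assumes "tame g"
  shows "integrable \<nu> g"
proof -
  obtain S where S: "bounded S" "AE x in \<nu>. x \<in> S" by (rule absorbing_set)
  obtain B where B: "\<And>y. y \<in> S \<Longrightarrow> \<bar>g y\<bar> \<le> B" using tameD[OF assms S(1)] by metis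
  show ?thesis
    by (rule integrable_AE_bounded[OF prob_\<nu>, of _ B])
      (use assms S(2) B in \<open>auto simp: tame_def measurable_cong_sets[OF sets_\<nu> refl] elim!: eventually_mono\<close>)
qed

lemma integral_avg:
  assumes g: "tame g"
  shows "(\<integral>x. avg m g x \<partial>\<nu>) = (\<integral>x. g x \<partial>\<nu>)"
proof -
  have pos: "(\<integral>x. avg m h x \<partial>\<nu>) = (\<integral>x. h x \<partial>\<nu>)" if h: "tame h" "\<And>y. 0 \<le> h y" for h
  proof -
    have nn: "0 \<le> avg m h x" for x unfolding avg_def using h(2) by simp
    have "ennreal (\<integral>x. avg m h x \<partial>\<nu>) = (\<integral>\<^sup>+x. ennreal (avg m h x) \<partial>\<nu>)"
      using integrable_\<nu>[OF tame_avg[OF h(1)]] nn by (simp add: nn_integral_eq_integral)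
    also have "\<dots> = (\<integral>\<^sup>+x. averaging m (\<lambda>y. ennreal (h y)) x \<partial>\<nu>)"
      unfolding averaging_def avg_def using tame_integrable[OF h(1)] h(2) by (simp add: nn_integral_eq_integral)
    also have "\<dots> = (\<integral>\<^sup>+x. ennreal (h x) \<partial>\<nu>)"
      using h(1) by (intro nn_integral_averaging) (auto simp: tame_def)
    also have "\<dots> = ennreal (\<integral>x. h x \<partial>\<nu>)"
      using integrable_\<nu>[OF h(1)] h(2) by (simp add: nn_integral_eq_integral)
    finally show ?thesis using nn h(2) by (simp add: ennreal_inj)
  qed
  have t: "tame (\<lambda>y. max 0 (g y))" "tame (\<lambda>y. max 0 (- g y))"
    unfolding tame_def
  proof -
    have b: "bounded (h ` S)" if S: "bounded S" and h: "\<And>y. \<bar>h y\<bar> \<le> \<bar>g y\<bar>" for h :: "'a \<Rightarrow> real" and S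
      using tameD[OF g S] h unfolding bounded_iff by (metis (no_types, lifting) imageE order_trans real_norm_def)
    show "(\<lambda>y. max 0 (g y)) \<in> borel_measurable borel \<and> (\<forall>S. bounded S \<longrightarrow> bounded ((\<lambda>y. max 0 (g y)) ` S))"
      using g by (auto simp: tame_def intro!: b)
    show "(\<lambda>y. max 0 (- g y)) \<in> borel_measurable borel \<and> (\<forall>S. bounded S \<longrightarrow> bounded ((\<lambda>y. max 0 (- g y)) ` S))"
      using g by (auto simp: tame_def intro!: b)
  qed
  have eq: "g = (\<lambda>y. max 0 (g y) - max 0 (- g y))" by (auto simp: max_def)
  have "avg m g x = avg m (\<lambda>y. max 0 (g y)) x - avg m (\<lambda>y. max 0 (- g y)) x" for x
    unfolding avg_def using t[THEN tame_integrable, of x] by (subst eq) simp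
  then have "(\<integral>x. avg m g x \<partial>\<nu>) = (\<integral>x. avg m (\<lambda>y. max 0 (g y)) x \<partial>\<nu>) - (\<integral>x. avg m (\<lambda>y. max 0 (- g y)) x \<partial>\<nu>)"
    using t[THEN tame_avg, THEN integrable_\<nu>] by simp
  also have "\<dots> = (\<integral>x. max 0 (g x) \<partial>\<nu>) - (\<integral>x. max 0 (- g x) \<partial>\<nu>)"
    using pos[OF t(1)] pos[OF t(2)] by simp
  also have "\<dots> = (\<integral>x. g x \<partial>\<nu>)"
    using t[THEN integrable_\<nu>] by (subst (3) eq) simp
  finally show ?thesis .
qed

lemma integral_iterate: "tame g \<Longrightarrow> (\<integral>x. (avg m ^^ n) g x \<partial>\<nu>) = (\<integral>x. g x \<partial>\<nu>)"
  by (induction n) (simp_all add: integral_avg tame_iterate)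

end

subsection \<open>Telescoping along the iterates\<close>

lemma ennreal_add_le: "ennreal (a + b) \<le> ennreal a + ennreal b"
proof -
  have "ennreal (a + b) \<le> ennreal (max 0 a + max 0 b)" by (intro ennreal_leI) auto
  also have "\<dots> = ennreal (max 0 a) + ennreal (max 0 b)" by (rule ennreal_plus) auto
  also have "\<dots> = ennreal a + ennreal b" by (simp add: max_def ennreal_neg)
  finally show ?thesis .
qed

context invariant_walk
begin

lemma iterate_converges:
  assumes f: "gradient_bound lam f F" and F: "slowly_varying lam F"
  obtains K where "0 \<le> K" "\<And>t. AE x in \<nu>. \<bar>(avg m ^^ t) f x - (\<integral>x. f x \<partial>\<nu>)\<bar> \<le> \<theta> ^ t * K"
proof -
  obtain S where S: "bounded S" "\<And>x. x \<in> S \<Longrightarrow> supp (m x) \<subseteq> S" "AE x in \<nu>. x \<in> S"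
    by (rule absorbing_set) blast
  have tF: "tame F" using slowly_varying_tame[OF F] lam by simp
  have tf: "tame f" using gradient_bound_tame[OF f F] lam by simp
  obtain B where B: "0 \<le> B" "\<And>x. x \<in> S \<Longrightarrow> \<bar>F x\<bar> \<le> B" using tameD[OF tF S(1)] by metis
  obtain D where D: "\<And>x y. x \<in> S \<Longrightarrow> y \<in> S \<Longrightarrow> dist x y \<le> D"
    using bounded_two_points S(1) by metis
  obtain x0 where "x0 \<in> S" using prob_AE_ex[OF prob_\<nu> S(3)] by blast
  then have D0: "0 \<le> D" using D[of x0 x0] by simp
  have FB: "(avg m ^^ t) F x \<le> B" if "x \<in> S" for t x
    using that
  proof (induction t arbitrary: x)
    case 0
    then show ?case using B(2)[of x] by simp
  next
    case (Suc t)
    have "avg m ((avg m ^^ t) F) x \<le> avg m (\<lambda>_. B) x"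
      using Suc S(2) by (intro avg_mono tame_iterate tF tame_const) auto
    then show ?case by simp
  qed
  let ?K = "D * exp (lam * D) * B"
  have close: "\<bar>(avg m ^^ t) f x - (avg m ^^ t) f y\<bar> \<le> \<theta> ^ t * ?K" if "x \<in> S" "y \<in> S" for t x y
  proof -
    have "\<bar>(avg m ^^ t) f x - (avg m ^^ t) f y\<bar>
        \<le> dist x y * exp (lam * dist x y) * (\<theta> ^ t * (avg m ^^ t) F x)"
      using iterate_gradient_bound[OF f F, of t] by (simp add: gradient_bound_def)
    also have "\<dots> \<le> D * exp (lam * D) * (\<theta> ^ t * B)"
      using D[OF that] D0 \<theta> lam FB[OF that(1)] iterate_slowly_varying[OF F, of t]
      by (intro mult_mono mult_nonneg_nonneg) (auto simp: slowly_varying_def)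
    finally show ?thesis by (simp add: mult_ac)
  qed
  show thesis
  proof (rule that[of ?K])
    show "0 \<le> ?K" using D0 B(1) by simp
    fix t
    let ?f = "(avg m ^^ t) f"
    have it: "integrable \<nu> ?f" by (intro integrable_\<nu> tame_iterate tf)
    show "AE x in \<nu>. \<bar>?f x - (\<integral>x. f x \<partial>\<nu>)\<bar> \<le> \<theta> ^ t * ?K"
      using S(3)
    proof eventually_elim
      case (elim x)
      have "?f x - (\<integral>x. f x \<partial>\<nu>) = (\<integral>y. ?f x - ?f y \<partial>\<nu>)"
        using it integral_iterate[OF tf, of t] by (simp add: nu.prob_space)
      then have "\<bar>?f x - (\<integral>x. f x \<partial>\<nu>)\<bar> \<le> (\<integral>y. \<bar>?f x - ?f y\<bar> \<partial>\<nu>)"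
        using integral_abs_bound[of \<nu> "\<lambda>y. ?f x - ?f y"] by simp
      also have "\<dots> \<le> (\<integral>y. \<theta> ^ t * ?K \<partial>\<nu>)"
      proof (rule integral_mono_AE)
        show "AE y in \<nu>. \<bar>?f x - ?f y\<bar> \<le> \<theta> ^ t * ?K"
          using S(3) by eventually_elim (rule close[OF elim])
      qed (use it in auto)
      finally show ?case by (simp add: nu.prob_space)
    qed
  qed
qed

lemma telescoping_bound:
  assumes f: "gradient_bound lam f F" and F: "slowly_varying lam F"
    and \<Phi>: "\<And>t. tame (\<lambda>x. \<Phi> ((avg m ^^ t) f x))" "isCont \<Phi> (\<integral>x. f x \<partial>\<nu>)"
    and gap: "\<And>t x. ennreal (avg m (\<lambda>y. \<Phi> ((avg m ^^ t) f y)) x - \<Phi> ((avg m ^^ Suc t) f x)) \<le> B t x"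
  shows "ennreal ((\<integral>x. \<Phi> (f x) \<partial>\<nu>) - \<Phi> (\<integral>x. f x \<partial>\<nu>)) \<le> (\<Sum>t. \<integral>\<^sup>+x. B t x \<partial>\<nu>)"
proof -
  define c where "c = (\<integral>x. f x \<partial>\<nu>)"
  define a where "a t = (\<integral>x. \<Phi> ((avg m ^^ t) f x) \<partial>\<nu>)" for t
  obtain K where K: "0 \<le> K" "\<And>t. AE x in \<nu>. \<bar>(avg m ^^ t) f x - c\<bar> \<le> \<theta> ^ t * K"
    unfolding c_def by (rule iterate_converges[OF f F]) blast
  have "(\<lambda>t. \<theta> ^ t * K) \<longlonglongrightarrow> 0"
    using \<theta> by (auto intro!: tendsto_mult_left_zero LIMSEQ_power_zero)
  have a_lim: "a \<longlonglongrightarrow> \<Phi> c"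
  proof (rule LIMSEQ_I)
    fix r :: real assume r: "0 < r"
    obtain d where d: "0 < d" "\<And>u. \<bar>u - c\<bar> < d \<Longrightarrow> \<bar>\<Phi> u - \<Phi> c\<bar> < r / 2"
      using \<Phi>(2) r unfolding c_def[symmetric] continuous_at_eps_delta
      by (metis dist_real_def half_gt_zero)
    obtain N where N: "\<And>t. N \<le> t \<Longrightarrow> \<theta> ^ t * K < d"
      using LIMSEQ_D[OF \<open>(\<lambda>t. \<theta> ^ t * K) \<longlonglongrightarrow> 0\<close> d(1)] by (auto intro: le_less_trans[OF abs_ge_self])
    show "\<exists>no. \<forall>t\<ge>no. norm (a t - \<Phi> c) < r"
    proof (intro exI[of _ N] allI impI)
      fix t assume t: "N \<le> t"
      have i: "integrable \<nu> (\<lambda>x. \<Phi> ((avg m ^^ t) f x) - \<Phi> c)"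
        using integrable_\<nu>[OF \<Phi>(1)] by simp
      have "a t - \<Phi> c = (\<integral>x. \<Phi> ((avg m ^^ t) f x) - \<Phi> c \<partial>\<nu>)"
        using integrable_\<nu>[OF \<Phi>(1)] by (simp add: a_def nu.prob_space)
      then have "\<bar>a t - \<Phi> c\<bar> \<le> (\<integral>x. \<bar>\<Phi> ((avg m ^^ t) f x) - \<Phi> c\<bar> \<partial>\<nu>)"
        by (simp add: integral_abs_bound)
      also have "\<dots> \<le> (\<integral>x. r / 2 \<partial>\<nu>)"
      proof (rule integral_mono_AE)
        show "AE x in \<nu>. \<bar>\<Phi> ((avg m ^^ t) f x) - \<Phi> c\<bar> \<le> r / 2"
          using K(2)[of t]
        proof eventually_elim
          case (elim x)
          then have "\<bar>(avg m ^^ t) f x - c\<bar> < d" using N[OF t] by linarith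
          from d(2)[OF this] show ?case by (rule less_imp_le)
        qed
      qed (use i in auto)
      finally show "norm (a t - \<Phi> c) < r" using r by (simp add: nu.prob_space)
    qed
  qed
  have step: "ennreal (a t - a (Suc t)) \<le> (\<integral>\<^sup>+x. B t x \<partial>\<nu>)" for t
  proof -
    let ?g = "\<lambda>x. avg m (\<lambda>y. \<Phi> ((avg m ^^ t) f y)) x - \<Phi> ((avg m ^^ Suc t) f x)"
    have i: "integrable \<nu> (avg m (\<lambda>y. \<Phi> ((avg m ^^ t) f y)))"
      by (intro integrable_\<nu> tame_avg \<Phi>(1))
    have "a t - a (Suc t) = (\<integral>x. ?g x \<partial>\<nu>)"
      using i integrable_\<nu>[OF \<Phi>(1)[of "Suc t"]] integral_avg[OF \<Phi>(1)[of t]] by (simp add: a_def)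
    also have "ennreal \<dots> \<le> (\<integral>\<^sup>+x. ennreal (?g x) \<partial>\<nu>)"
      by (intro ennreal_integral_le_nn_integral Bochner_Integration.integrable_diff i integrable_\<nu>[OF \<Phi>(1)])
    also have "\<dots> \<le> (\<integral>\<^sup>+x. B t x \<partial>\<nu>)" by (intro nn_integral_mono gap)
    finally show ?thesis .
  qed
  have partial: "ennreal (a 0 - a N) \<le> (\<Sum>t<N. \<integral>\<^sup>+x. B t x \<partial>\<nu>)" for N
  proof (induction N)
    case (Suc N)
    have "ennreal (a 0 - a (Suc N)) = ennreal ((a 0 - a N) + (a N - a (Suc N)))" by simp
    also have "\<dots> \<le> ennreal (a 0 - a N) + ennreal (a N - a (Suc N))" by (rule ennreal_add_le)
    also have "\<dots> \<le> (\<Sum>t<Suc N. \<integral>\<^sup>+x. B t x \<partial>\<nu>)" using Suc step[of N] by (simp add: add_mono)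
    finally show ?case .
  qed simp
  have "(\<lambda>N. ennreal (a 0 - a N)) \<longlonglongrightarrow> ennreal (a 0 - \<Phi> c)"
    by (intro tendsto_ennrealI tendsto_intros a_lim)
  then have "ennreal (a 0 - \<Phi> c) \<le> (\<Sum>t. \<integral>\<^sup>+x. B t x \<partial>\<nu>)"
    by (rule LIMSEQ_le_const2) (intro exI allI impI order_trans[OF partial] sum_le_suminf; simp)
  then show ?thesis by (simp add: a_def c_def)
qed

lemma nn_integral_step_measure:
  assumes "\<phi> \<in> borel_measurable borel"
  shows "(\<integral>\<^sup>+p. \<phi> p \<partial>step_measure m \<nu>) = (\<integral>\<^sup>+x. \<integral>\<^sup>+y. \<phi> (x, y) \<partial>m x \<partial>\<nu>)"
proof -
  have p: "Pair x \<in> m x \<rightarrow>\<^sub>M borel" for x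
    by (simp add: measurable_cong_sets[OF sets_m refl] borel_prod[symmetric])
  have k: "(\<lambda>x. distr (m x) borel (\<lambda>y. (x, y))) \<in> \<nu> \<rightarrow>\<^sub>M subprob_algebra borel"
    unfolding measurable_cong_sets[OF sets_\<nu> refl]
    by (rule measurable_distr2[OF _ subprob_kernel]) (simp add: borel_prod[symmetric])
  show ?thesis
    unfolding step_measure_def
    by (subst nn_integral_bind[OF assms k]) (simp add: nn_integral_distr[OF p] assms)
qed

lemma reversible_averaging:
  assumes rev: "reversible m \<nu>" and g: "g \<in> borel_measurable borel" and h: "h \<in> borel_measurable borel"
  shows "(\<integral>\<^sup>+x. g x * averaging m h x \<partial>\<nu>) = (\<integral>\<^sup>+x. averaging m g x * h x \<partial>\<nu>)"
proof -
  note g[measurable] h[measurable]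
  have e: "(\<integral>\<^sup>+x. g' x * averaging m h' x \<partial>\<nu>) = (\<integral>\<^sup>+p. g' (fst p) * h' (snd p) \<partial>step_measure m \<nu>)"
    if [measurable]: "g' \<in> borel_measurable borel" "h' \<in> borel_measurable borel" for g' h'
  proof -
    have "(\<lambda>p. g' (fst p) * h' (snd p)) \<in> borel_measurable borel"
      unfolding polish_borel_pair by measurable
    from nn_integral_step_measure[OF this] show ?thesis
      unfolding averaging_def using that(2)
      by (simp add: nn_integral_cmult measurable_cong_sets[OF sets_m refl])
  qed
  have swap: "(\<lambda>(x, y). (y, x)) \<in> step_measure m \<nu> \<rightarrow>\<^sub>M (borel :: ('a \<times> 'a) measure)"
  proof -
    have "space \<nu> \<noteq> {}" using nu.not_empty .
    then have "sets (step_measure m \<nu>) = sets borel" unfolding step_measure_def by (rule sets_bind[rotated]) simp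
    then show ?thesis
      unfolding measurable_cong_sets[OF \<open>sets (step_measure m \<nu>) = sets borel\<close> refl] polish_borel_pair
      by measurable
  qed
  have gh: "(\<lambda>p. g (fst p) * h (snd p)) \<in> borel_measurable borel"
    unfolding polish_borel_pair by measurable
  have "(\<integral>\<^sup>+x. g x * averaging m h x \<partial>\<nu>)
      = (\<integral>\<^sup>+p. g (fst p) * h (snd p) \<partial>distr (step_measure m \<nu>) borel (\<lambda>(x, y). (y, x)))"
    unfolding e[OF g h] using rev by (simp add: reversible_def)
  also have "\<dots> = (\<integral>\<^sup>+p. h (fst p) * g (snd p) \<partial>step_measure m \<nu>)"
    by (subst nn_integral_distr[OF swap]) (simp_all add: gh case_prod_unfold mult.commute)
  also have "\<dots> = (\<integral>\<^sup>+x. averaging m g x * h x \<partial>\<nu>)"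
    unfolding e[OF h g, symmetric] by (simp add: mult.commute)
  finally show ?thesis .
qed

lemma reversible_averaging_iterate:
  assumes rev: "reversible m \<nu>" and g: "g \<in> borel_measurable borel" and h: "h \<in> borel_measurable borel"
  shows "(\<integral>\<^sup>+x. g x * (averaging m ^^ n) h x \<partial>\<nu>) = (\<integral>\<^sup>+x. (averaging m ^^ n) g x * h x \<partial>\<nu>)"
  using g
proof (induction n arbitrary: g)
  case (Suc n)
  have "(\<integral>\<^sup>+x. g x * (averaging m ^^ Suc n) h x \<partial>\<nu>) = (\<integral>\<^sup>+x. averaging m g x * (averaging m ^^ n) h x \<partial>\<nu>)"
    using reversible_averaging[OF rev Suc.prems borel_measurable_averaging_iterate[OF subprob_kernel h]] by simp
  also have "\<dots> = (\<integral>\<^sup>+x. (averaging m ^^ n) (averaging m g) x * h x \<partial>\<nu>)"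
    by (rule Suc.IH[OF borel_measurable_averaging[OF subprob_kernel Suc.prems]])
  finally show ?case by (simp add: funpow_swap1)
qed simp

lemma functional_inequality:
  assumes f: "gradient_bound lam f F" and F: "slowly_varying lam F"
    and v: "tame v" "\<And>x. 0 < v x"
    and \<Phi>: "\<And>t. tame (\<lambda>x. \<Phi> ((avg m ^^ t) f x))" "isCont \<Phi> (\<integral>x. f x \<partial>\<nu>)"
    and gap: "\<And>t x. ennreal (avg m (\<lambda>y. \<Phi> ((avg m ^^ t) f y)) x - \<Phi> ((avg m ^^ Suc t) f x))
      \<le> evariance (m x) ((avg m ^^ t) f) * ennreal (1 / (avg m ^^ Suc t) v x)"
  defines "H \<equiv> \<lambda>x. ennreal ((F x)\<^sup>2 / v x)"
  shows "ennreal ((\<integral>x. \<Phi> (f x) \<partial>\<nu>) - \<Phi> (\<integral>x. f x \<partial>\<nu>))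
      \<le> (SUP x. 4 * max_variance m x / ennreal \<kappa>) * (\<integral>\<^sup>+x. H x \<partial>\<nu>)" (is ?general)
    and "reversible m \<nu> \<Longrightarrow> ennreal ((\<integral>x. \<Phi> (f x) \<partial>\<nu>) - \<Phi> (\<integral>x. f x \<partial>\<nu>))
      \<le> (\<integral>\<^sup>+x. 2 * (\<Sum>t. ennreal (\<theta> ^ (2 * t)) * (averaging m ^^ (t + 1)) (max_variance m) x) * H x \<partial>\<nu>)"
      (is "_ \<Longrightarrow> ?reversible")
proof -
  let ?W = "max_variance m" and ?I = "ennreal ((\<integral>x. \<Phi> (f x) \<partial>\<nu>) - \<Phi> (\<integral>x. f x \<partial>\<nu>))"
  have tF: "tame F" using slowly_varying_tame[OF F] lam by simp
  have [measurable]: "F \<in> borel_measurable borel" "v \<in> borel_measurable borel"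
    using tF v(1) by (auto simp: tame_def)
  have H: "H \<in> borel_measurable borel" unfolding H_def by measurable
  have AH: "(averaging m ^^ n) H \<in> borel_measurable borel" for n
    by (rule borel_measurable_averaging_iterate[OF subprob_kernel H])
  have AW: "(averaging m ^^ n) ?W \<in> borel_measurable borel" for n
    by (rule borel_measurable_averaging_iterate[OF subprob_kernel borel_measurable_max_variance])
  note meas_\<nu> = measurable_cong_sets[OF sets_\<nu> refl]
  have "?I \<le> (\<Sum>t. \<integral>\<^sup>+x. ennreal (2 * \<theta> ^ (2 * t)) * (?W x * (averaging m ^^ Suc t) H x) \<partial>\<nu>)"
  proof (rule telescoping_bound[OF f F \<Phi>])
    fix t x
    let ?G = "(avg m ^^ Suc t) F x" and ?V = "(avg m ^^ Suc t) v x"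
    have V: "0 < ?V" by (rule iterate_pos[OF v])
    have "ennreal (avg m (\<lambda>y. \<Phi> ((avg m ^^ t) f y)) x - \<Phi> ((avg m ^^ Suc t) f x))
        \<le> ennreal (2 * \<theta> ^ (2 * t) * ?G\<^sup>2) * ?W x * ennreal (1 / ?V)"
      by (rule order_trans[OF gap mult_right_mono[OF evariance_iterate[OF f F]]]) simp
    also have "\<dots> = ennreal (2 * \<theta> ^ (2 * t)) * (?W x * (ennreal (?G\<^sup>2) * ennreal (1 / ?V)))"
      using \<theta> by (simp add: ennreal_mult mult_ac)
    also have "ennreal (?G\<^sup>2) * ennreal (1 / ?V) = ennreal (?G\<^sup>2 / ?V)"
      using V by (simp flip: ennreal_mult)
    also have "ennreal (2 * \<theta> ^ (2 * t)) * (?W x * ennreal (?G\<^sup>2 / ?V))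
        \<le> ennreal (2 * \<theta> ^ (2 * t)) * (?W x * (averaging m ^^ Suc t) H x)"
      unfolding H_def by (intro mult_left_mono cauchy_schwarz_iterate tF v) auto
    finally show "ennreal (avg m (\<lambda>y. \<Phi> ((avg m ^^ t) f y)) x - \<Phi> ((avg m ^^ Suc t) f x))
        \<le> ennreal (2 * \<theta> ^ (2 * t)) * (?W x * (averaging m ^^ Suc t) H x)" .
  qed
  also have "\<dots> = (\<Sum>t. ennreal (2 * \<theta> ^ (2 * t)) * (\<integral>\<^sup>+x. ?W x * (averaging m ^^ Suc t) H x \<partial>\<nu>))"
    using borel_measurable_max_variance AH[of "Suc _"]
    by (intro suminf_cong nn_integral_cmult) (simp add: meas_\<nu>)
  finally have main: "?I \<le> (\<Sum>t. ennreal (2 * \<theta> ^ (2 * t)) * (\<integral>\<^sup>+x. ?W x * (averaging m ^^ Suc t) H x \<partial>\<nu>))" .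
  show ?general
  proof -
    let ?S = "SUP x. ?W x" and ?J = "\<integral>\<^sup>+x. H x \<partial>\<nu>"
    have "(\<integral>\<^sup>+x. ?W x * (averaging m ^^ Suc t) H x \<partial>\<nu>) \<le> ?S * ?J" for t
    proof -
      have "(\<integral>\<^sup>+x. ?W x * (averaging m ^^ Suc t) H x \<partial>\<nu>) \<le> (\<integral>\<^sup>+x. ?S * (averaging m ^^ Suc t) H x \<partial>\<nu>)"
        by (intro nn_integral_mono mult_right_mono SUP_upper) auto
      also have "\<dots> = ?S * (\<integral>\<^sup>+x. (averaging m ^^ Suc t) H x \<partial>\<nu>)"
        using AH[of "Suc t"] by (intro nn_integral_cmult) (simp add: meas_\<nu>)
      finally show ?thesis unfolding nn_integral_averaging_iterate[OF H] .
    qed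
    then have "?I \<le> (\<Sum>t. ennreal (2 * \<theta> ^ (2 * t)) * (?S * ?J))"
      by (intro order_trans[OF main] suminf_le mult_left_mono) auto
    also have "\<dots> = (\<Sum>t. ennreal (2 * \<theta> ^ (2 * t))) * (?S * ?J)" by simp
    also have "(\<Sum>t. ennreal (2 * \<theta> ^ (2 * t))) \<le> ennreal (4 / \<kappa>)"
    proof -
      have \<theta>2: "\<theta>\<^sup>2 \<le> 1 - \<kappa> / 2"
        using \<kappa> mult_left_mono[of \<theta> 1 \<theta>] \<theta> by (simp add: power2_eq_square \<theta>_def)
      then have lt: "\<bar>\<theta>\<^sup>2\<bar> < 1" using \<kappa> by simp
      have "(\<lambda>t. 2 * \<theta> ^ (2 * t)) sums (2 * (1 / (1 - \<theta>\<^sup>2)))"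
        unfolding power_mult using lt by (intro sums_mult geometric_sums) simp
      then have "(\<Sum>t. ennreal (2 * \<theta> ^ (2 * t))) = ennreal (2 * (1 / (1 - \<theta>\<^sup>2)))"
        using \<theta> by (intro suminf_ennreal_eq) auto
      also have "\<dots> \<le> ennreal (4 / \<kappa>)"
        using \<theta>2 \<kappa> by (intro ennreal_leI) (simp add: field_simps)
      finally show ?thesis .
    qed
    also have "ennreal (4 / \<kappa>) * (?S * ?J) = (SUP x. ennreal (4 / \<kappa>) * ?W x) * ?J"
      by (simp only: SUP_mult_left_ennreal mult.assoc[symmetric])
    also have "(\<lambda>x. ennreal (4 / \<kappa>) * ?W x) = (\<lambda>x. 4 * ?W x / ennreal \<kappa>)"
      using \<kappa> by (simp add: divide_ennreal[symmetric] ennreal_times_divide mult.commute)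
    finally show ?thesis by (simp add: mult_right_mono)
  qed
  show ?reversible if rev: "reversible m \<nu>"
  proof -
    have "?I \<le> (\<Sum>t. ennreal (2 * \<theta> ^ (2 * t)) * (\<integral>\<^sup>+x. (averaging m ^^ Suc t) ?W x * H x \<partial>\<nu>))"
      using main unfolding reversible_averaging_iterate[OF rev borel_measurable_max_variance H] .
    also have "\<dots> = (\<Sum>t. \<integral>\<^sup>+x. ennreal (2 * \<theta> ^ (2 * t)) * ((averaging m ^^ Suc t) ?W x * H x) \<partial>\<nu>)"
      using AW[of "Suc _"] H by (intro suminf_cong nn_integral_cmult[symmetric]) (simp add: meas_\<nu>)
    also have "\<dots> = (\<integral>\<^sup>+x. (\<Sum>t. ennreal (2 * \<theta> ^ (2 * t)) * ((averaging m ^^ Suc t) ?W x * H x)) \<partial>\<nu>)"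
      using AW[of "Suc _"] H by (intro nn_integral_suminf[symmetric]) (simp add: meas_\<nu>)
    also have "\<dots> = (\<integral>\<^sup>+x. 2 * (\<Sum>t. ennreal (\<theta> ^ (2 * t)) * (averaging m ^^ (t + 1)) ?W x) * H x \<partial>\<nu>)"
      using \<theta> by (simp add: ennreal_mult mult.assoc flip: ennreal_suminf_cmult ennreal_suminf_multc)
    finally show ?thesis .
  qed
qed

end

lemma tame_square:
  assumes "tame g"
  shows "tame (\<lambda>x. (g x)\<^sup>2)"
  unfolding tame_def
proof (intro conjI allI impI)
  show "(\<lambda>x. (g x)\<^sup>2) \<in> borel_measurable borel" using assms by (auto simp: tame_def)
  fix S :: "'a set" assume "bounded S"
  then obtain B where B: "\<And>x. x \<in> S \<Longrightarrow> \<bar>g x\<bar> \<le> B" using tameD[OF assms] by metis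
  have "\<bar>(g x)\<^sup>2\<bar> \<le> B\<^sup>2" if "x \<in> S" for x
    using power_mono[OF B[OF that], of 2] by simp
  then show "bounded ((\<lambda>x. (g x)\<^sup>2) ` S)" by (auto simp: bounded_iff)
qed

lemma tame_mult_ln:
  assumes "tame g" "\<And>x. 0 < g x"
  shows "tame (\<lambda>x. g x * ln (g x))"
  unfolding tame_def
proof (intro conjI allI impI)
  show "(\<lambda>x. g x * ln (g x)) \<in> borel_measurable borel" using assms(1) by (auto simp: tame_def)
  fix S :: "'a set" assume "bounded S"
  then obtain B where B: "\<And>x. x \<in> S \<Longrightarrow> \<bar>g x\<bar> \<le> B" using tameD[OF assms(1)] by metis
  have "\<bar>g x * ln (g x)\<bar> \<le> B\<^sup>2 + 1" if "x \<in> S" for x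
  proof -
    have g: "0 < g x" "g x \<le> B" using assms(2)[of x] B[OF that] by auto
    have "g x * ln (g x) \<le> g x * g x"
      using g ln_le_minus_one[of "g x"] by (intro mult_left_mono) auto
    also have "\<dots> \<le> B\<^sup>2" unfolding power2_eq_square using g by (intro mult_mono) auto
    finally have 1: "g x * ln (g x) \<le> B\<^sup>2" .
    have "g x * - ln (g x) \<le> g x * (1 / g x)"
      using g ln_le_minus_one[of "1 / g x"] by (intro mult_left_mono) (auto simp: ln_div)
    then have "- (g x * ln (g x)) \<le> 1" using g by simp
    then show ?thesis using 1 zero_le_power2[of B] unfolding abs_le_iff by linarith
  qed
  then show "bounded ((\<lambda>x. g x * ln (g x)) ` S)" unfolding bounded_iff by auto
qed

lemma esqrt_power2: "(esqrt a)\<^sup>2 = a"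
  by (cases a) (auto simp: esqrt_def power2_eq_square simp flip: ennreal_mult)

lemma ennreal_double_quotient:
  fixes S W :: ennreal
  assumes "S < \<infinity>" "W < \<infinity>" "S = 0 \<Longrightarrow> W = 0"
  shows "S / (S / W) = W"
    and "0 < \<kappa> \<Longrightarrow> 4 * S / (ennreal \<kappa> * (S / W)) = 4 * W / ennreal \<kappa>"
proof -
  obtain s w where sw: "S = ennreal s" "0 \<le> s" "W = ennreal w" "0 \<le> w"
    using assms(1,2) by (cases S; cases W) auto
  show "S / (S / W) = W"
  proof (cases "s = 0 \<or> w = 0")
    case True
    then show ?thesis using assms(3) sw by (auto simp: ennreal_divide_zero ennreal_top_divide)
  next
    case False
    then show ?thesis using sw by (simp add: divide_ennreal)
  qed
  show "4 * S / (ennreal \<kappa> * (S / W)) = 4 * W / ennreal \<kappa>" if \<kappa>: "0 < \<kappa>"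
  proof (cases "s = 0 \<or> w = 0")
    case True
    then show ?thesis using assms(3) sw \<kappa> by (auto simp: ennreal_mult_top ennreal_divide_top)
  next
    case False
    then have "4 * S / (ennreal \<kappa> * (S / W)) = ennreal (4 * s / (\<kappa> * (s / w)))"
      using sw \<kappa> by (simp add: divide_ennreal flip: ennreal_mult ennreal_numeral)
    also have "4 * s / (\<kappa> * (s / w)) = 4 * w / \<kappa>" using False by (simp add: field_simps)
    also have "ennreal \<dots> = 4 * W / ennreal \<kappa>"
      using sw \<kappa> by (simp add: divide_ennreal flip: ennreal_mult ennreal_numeral)
    finally show ?thesis .
  qed
qed

context bounded_walk
begin

lemma max_variance_finite: "max_variance m x < \<infinity>"
proof -
  have "max_variance m x \<le> ennreal ((2 * \<sigma>)\<^sup>2)"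
    unfolding max_variance_def
  proof (rule SUP_least)
    fix g :: "'a \<Rightarrow> real" assume "g \<in> {f. 1-lipschitz_on UNIV f}"
    then have g: "1-lipschitz_on UNIV g" by simp
    have t: "tame g" by (rule lipschitz_tame[OF g])
    have bound: "(g y - avg m g x)\<^sup>2 \<le> (2 * \<sigma>)\<^sup>2" if y: "y \<in> supp (m x)" for y
    proof -
      have close: "\<bar>g y - g z\<bar> \<le> 2 * \<sigma>" if "z \<in> supp (m x)" for z
        using lipschitz_onD[OF g, of y z] supp_dist[OF y that] by (simp add: dist_real_def)
      have "avg m g x \<le> avg m (\<lambda>_. g y + 2 * \<sigma>) x"
        by (rule avg_mono[OF t tame_const]) (use close in \<open>auto simp: abs_le_iff algebra_simps\<close>)
      moreover have "avg m (\<lambda>_. g y - 2 * \<sigma>) x \<le> avg m g x"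
        by (rule avg_mono[OF tame_const t]) (use close in \<open>auto simp: abs_le_iff algebra_simps\<close>)
      ultimately have "\<bar>g y - avg m g x\<bar> \<le> 2 * \<sigma>" by (simp add: abs_le_iff)
      from power_mono[OF this, of 2] show ?thesis by simp
    qed
    have "evariance (m x) g \<le> (\<integral>\<^sup>+y. ennreal ((2 * \<sigma>)\<^sup>2) \<partial>m x)"
      unfolding evariance_def avg_def[symmetric]
      using AE_m_supp[of x] bound by (intro nn_integral_mono_AE) (auto elim!: eventually_mono intro: ennreal_leI)
    then show "evariance (m x) g \<le> ennreal ((2 * \<sigma>)\<^sup>2)"
      using prob_space.emeasure_space_1[OF prob, of x] by simp
  qed
  then show ?thesis by (rule le_less_trans) simp
qed

lemma spread_power2:
  "(spread m x)\<^sup>2 = (\<integral>\<^sup>+ z. (\<integral>\<^sup>+ y. ennreal ((dist y z)\<^sup>2) \<partial>m x) \<partial>m x) / 2"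
  by (simp add: spread_def esqrt_power2)

lemma spread_finite: "(spread m x)\<^sup>2 < \<infinity>"
proof -
  have inner: "(\<integral>\<^sup>+ y. ennreal ((dist y z)\<^sup>2) \<partial>m x) \<le> ennreal ((2 * \<sigma>)\<^sup>2)" if "z \<in> supp (m x)" for z
  proof -
    have "(\<integral>\<^sup>+ y. ennreal ((dist y z)\<^sup>2) \<partial>m x) \<le> (\<integral>\<^sup>+ y. ennreal ((2 * \<sigma>)\<^sup>2) \<partial>m x)"
    proof (rule nn_integral_mono_AE)
      show "AE y in m x. ennreal ((dist y z)\<^sup>2) \<le> ennreal ((2 * \<sigma>)\<^sup>2)"
        using AE_m_supp[of x] by eventually_elim (intro ennreal_leI power_mono supp_dist[OF _ that], auto)
    qed
    then show ?thesis using prob_space.emeasure_space_1[OF prob, of x] by simp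
  qed
  have "(\<integral>\<^sup>+ z. (\<integral>\<^sup>+ y. ennreal ((dist y z)\<^sup>2) \<partial>m x) \<partial>m x) \<le> (\<integral>\<^sup>+ z. ennreal ((2 * \<sigma>)\<^sup>2) \<partial>m x)"
    using AE_m_supp[of x] inner by (intro nn_integral_mono_AE) (auto elim!: eventually_mono)
  also have "\<dots> < \<infinity>" using prob_space.emeasure_space_1[OF prob, of x] by simp
  finally show ?thesis unfolding spread_power2 by (simp add: ennreal_divide_eq_top_iff less_top[symmetric])
qed

lemma max_variance_eq_0:
  assumes "(spread m x)\<^sup>2 = 0"
  shows "max_variance m x = 0"
proof -
  interpret prob_space "m x" by (rule prob)
  have [measurable]: "(\<lambda>z. \<integral>\<^sup>+ y. ennreal ((dist y z)\<^sup>2) \<partial>m x) \<in> borel_measurable (m x)"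
    by measurable
  have "AE z in m x. (\<integral>\<^sup>+ y. ennreal ((dist y z)\<^sup>2) \<partial>m x) = 0"
    using assms unfolding spread_power2 by (simp add: nn_integral_0_iff_AE)
  then obtain z where "(\<integral>\<^sup>+ y. ennreal ((dist y z)\<^sup>2) \<partial>m x) = 0" using prob_AE_ex[OF prob] by blast
  then have z: "AE y in m x. y = z" by (simp add: nn_integral_0_iff_AE ennreal_eq_0_iff)
  have "evariance (m x) g = 0" if "1-lipschitz_on UNIV g" for g
  proof -
    have "evariance (m x) g = evariance (m x) (\<lambda>_. g z)"
      using z by (intro evariance_cong_AE tame_measurable lipschitz_tame[OF that] tame_const)
        (auto elim!: eventually_mono)
    then show ?thesis using prob_space by (simp add: evariance_def)
  qed
  then have "max_variance m x \<le> 0" unfolding max_variance_def by (intro SUP_least) auto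
  then show ?thesis by simp
qed

lemma spread_local_dim:
  shows "(spread m x)\<^sup>2 / local_dim m x = max_variance m x"
    and "0 < \<kappa> \<Longrightarrow> 4 * (spread m x)\<^sup>2 / (ennreal \<kappa> * local_dim m x) = 4 * max_variance m x / ennreal \<kappa>"
  unfolding local_dim_def max_variance_def[symmetric]
  by (intro ennreal_double_quotient spread_finite max_variance_finite max_variance_eq_0; assumption)+

end

lemma range_gradient_slowly_varying:
  fixes f :: "'a::metric_space \<Rightarrow> real"
  assumes lam: "0 < lam" and fin: "\<And>x. range_gradient lam f x < \<infinity>"
  shows "slowly_varying lam (\<lambda>x. enn2real (range_gradient lam f x))"
  unfolding slowly_varying_def
proof (intro conjI allI)
  fix w w' :: 'a
  have "range_gradient lam f w \<le> ennreal (exp (2 * lam * dist w w')) * range_gradient lam f w'"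
    unfolding range_gradient_def[of lam f w]
  proof (rule SUP_least, clarify)
    fix y y' :: 'a assume ne: "y \<noteq> y'"
    have "lam * dist w' y \<le> lam * (dist w w' + dist w y)" "lam * dist w' y' \<le> lam * (dist w w' + dist w y')"
      using lam dist_triangle[of w' y w] dist_triangle[of w' y' w]
      by (auto simp: dist_commute intro!: mult_left_mono)
    then have e: "exp (- lam * dist w y - lam * dist w y')
        \<le> exp (2 * lam * dist w w') * exp (- lam * dist w' y - lam * dist w' y')"
      by (simp add: algebra_simps flip: exp_add)
    have "\<bar>f y - f y'\<bar> / dist y y' * exp (- lam * dist w y - lam * dist w y')
        \<le> \<bar>f y - f y'\<bar> / dist y y' * (exp (2 * lam * dist w w') * exp (- lam * dist w' y - lam * dist w' y'))"
      by (intro mult_left_mono e) auto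
    also have "\<dots> = exp (2 * lam * dist w w')
        * (\<bar>f y - f y'\<bar> / dist y y' * exp (- lam * dist w' y - lam * dist w' y'))" by (simp add: mult_ac)
    finally have "ennreal (\<bar>f y - f y'\<bar> / dist y y' * exp (- lam * dist w y - lam * dist w y'))
        \<le> ennreal (exp (2 * lam * dist w w'))
          * ennreal (\<bar>f y - f y'\<bar> / dist y y' * exp (- lam * dist w' y - lam * dist w' y'))"
      by (subst ennreal_mult[symmetric]) (auto intro: ennreal_leI)
    also have "\<dots> \<le> ennreal (exp (2 * lam * dist w w')) * range_gradient lam f w'"
      unfolding range_gradient_def using ne by (intro mult_left_mono SUP_upper2[of "(y, y')"]) auto
    finally show "ennreal (\<bar>f y - f y'\<bar> / dist y y' * exp (- lam * dist w y - lam * dist w y'))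
        \<le> ennreal (exp (2 * lam * dist w w')) * range_gradient lam f w'" .
  qed
  then have "enn2real (range_gradient lam f w)
      \<le> enn2real (ennreal (exp (2 * lam * dist w w')) * range_gradient lam f w')"
    using fin[of w'] by (intro enn2real_mono) (auto simp: ennreal_mult_less_top)
  then show "enn2real (range_gradient lam f w)
      \<le> exp (2 * lam * dist w w') * enn2real (range_gradient lam f w')"
    by (simp add: enn2real_mult)
qed simp

lemma range_gradient_gradient_bound:
  fixes f :: "'a::metric_space \<Rightarrow> real"
  assumes fin: "\<And>x. range_gradient lam f x < \<infinity>"
  shows "gradient_bound lam f (\<lambda>x. enn2real (range_gradient lam f x))"
  unfolding gradient_bound_def
proof (intro allI)
  fix z z' :: 'a
  show "\<bar>f z - f z'\<bar> \<le> dist z z' * exp (lam * dist z z') * enn2real (range_gradient lam f z)"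
  proof (cases "z = z'")
    case False
    have "ennreal (\<bar>f z - f z'\<bar> / dist z z' * exp (- lam * dist z z - lam * dist z z')) \<le> range_gradient lam f z"
      unfolding range_gradient_def using False by (intro SUP_upper2[of "(z, z')"]) auto
    also have "\<dots> = ennreal (enn2real (range_gradient lam f z))" using fin[of z] by simp
    finally have "\<bar>f z - f z'\<bar> / dist z z' * exp (- (lam * dist z z')) \<le> enn2real (range_gradient lam f z)"
      by (simp add: ennreal_le_iff)
    then show ?thesis using False by (simp add: exp_minus field_simps)
  qed simp
qed

subsection \<open>Functional inequalities\<close>

context invariant_walk
begin

lemma evariance_\<nu>:
  assumes "tame g"
  shows "evariance \<nu> g = ennreal ((\<integral>x. (g x)\<^sup>2 \<partial>\<nu>) - (\<integral>x. g x \<partial>\<nu>)\<^sup>2)"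
proof -
  obtain S where S: "bounded S" "AE x in \<nu>. x \<in> S" by (rule absorbing_set)
  obtain B where "\<And>y. y \<in> S \<Longrightarrow> \<bar>g y\<bar> \<le> B" using tameD[OF assms S(1)] by metis
  then have "AE y in \<nu>. \<bar>g y\<bar> \<le> B" using S(2) by (auto elim!: eventually_mono)
  then show ?thesis
    using assms by (intro evariance_bounded prob_\<nu>) (simp_all add: tame_def measurable_cong_sets[OF sets_\<nu> refl])
qed

lemma eentropy_\<nu>:
  assumes g: "tame g" "\<And>x. 0 < g x"
  shows "eentropy \<nu> g = ereal ((\<integral>x. g x * ln (g x) \<partial>\<nu>) - (\<integral>x. g x \<partial>\<nu>) * ln (\<integral>x. g x \<partial>\<nu>))"
proof -
  let ?h = "\<lambda>x. g x * ln (g x)"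
  have i: "integrable \<nu> ?h" by (intro integrable_\<nu> tame_mult_ln g)
  have i': "integrable \<nu> (\<lambda>x. max 0 (?h x))" "integrable \<nu> (\<lambda>x. max 0 (- ?h x))"
    by (intro integrable_max integrable_minus i; simp)+
  have "(\<integral>x. max 0 (?h x) \<partial>\<nu>) - (\<integral>x. max 0 (- ?h x) \<partial>\<nu>) = (\<integral>x. max 0 (?h x) - max 0 (- ?h x) \<partial>\<nu>)"
    by (rule Bochner_Integration.integral_diff[OF i', symmetric])
  also have "\<dots> = (\<integral>x. ?h x \<partial>\<nu>)" by (intro Bochner_Integration.integral_cong) (auto simp: max_def)
  finally have diff: "(\<integral>x. max 0 (?h x) \<partial>\<nu>) - (\<integral>x. max 0 (- ?h x) \<partial>\<nu>) = (\<integral>x. ?h x \<partial>\<nu>)" .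
  have "enn2ereal (\<integral>\<^sup>+x. ennreal (max 0 (?h x)) \<partial>\<nu>) = ereal (\<integral>x. max 0 (?h x) \<partial>\<nu>)"
    "enn2ereal (\<integral>\<^sup>+x. ennreal (max 0 (- ?h x)) \<partial>\<nu>) = ereal (\<integral>x. max 0 (- ?h x) \<partial>\<nu>)"
    unfolding nn_integral_eq_integral[OF i'(1) AE_I2[OF max.cobounded1]]
      nn_integral_eq_integral[OF i'(2) AE_I2[OF max.cobounded1]]
    by (intro enn2ereal_ennreal integral_nonneg_AE AE_I2 max.cobounded1)+
  then show ?thesis unfolding eentropy_def by (simp only: ereal_minus diff)
qed

lemma integral_\<nu>_pos:
  assumes g: "tame g" "\<And>x. 0 < g x"
  shows "0 < (\<integral>x. g x \<partial>\<nu>)"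
proof -
  have "0 \<le> (\<integral>x. g x \<partial>\<nu>)" using g(2) by (intro integral_nonneg_AE) (auto intro: less_imp_le)
  moreover have "(\<integral>x. g x \<partial>\<nu>) \<noteq> 0"
  proof
    assume "(\<integral>x. g x \<partial>\<nu>) = 0"
    then have "AE y in \<nu>. g y = 0"
      using g integrable_\<nu>[OF g(1)] by (subst (asm) integral_nonneg_eq_0_iff_AE) (auto intro: less_imp_le)
    then have "AE y in \<nu>. False" by eventually_elim (use g(2) in \<open>metis less_irrefl\<close>)
    then show False by simp
  qed
  ultimately show ?thesis by simp
qed

lemma local_weight_eq:
  "local_weight m \<kappa> x
    = 2 * (\<Sum>t. ennreal (\<theta> ^ (2 * t)) * (averaging m ^^ (t + 1)) (max_variance m) x)"
  unfolding local_weight_def spread_local_dim(1) \<theta>_def ..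

lemma poincare:
  assumes f: "gradient_bound lam f F" and F: "slowly_varying lam F"
  shows "evariance \<nu> f \<le> (SUP x. 4 * max_variance m x / ennreal \<kappa>) * (\<integral>\<^sup>+x. ennreal ((F x)\<^sup>2) \<partial>\<nu>)"
    and "reversible m \<nu> \<Longrightarrow> evariance \<nu> f \<le> (\<integral>\<^sup>+x. local_weight m \<kappa> x * ennreal ((F x)\<^sup>2) \<partial>\<nu>)"
proof -
  have tf: "tame f" using gradient_bound_tame[OF f F] lam by simp
  have v: "(avg m ^^ t) (\<lambda>_. 1) = (\<lambda>_. 1)" for t by (induction t) auto
  have gap: "ennreal (avg m (\<lambda>y. ((avg m ^^ t) f y)\<^sup>2) x - ((avg m ^^ Suc t) f x)\<^sup>2)
      \<le> evariance (m x) ((avg m ^^ t) f) * ennreal (1 / (avg m ^^ Suc t) (\<lambda>_. 1) x)" for t x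
    unfolding v evariance_avg[OF tame_iterate[OF tf]] by simp
  note * = functional_inequality[OF f F tame_const[of 1] _ tame_square[OF tame_iterate[OF tf]] _ gap]
  show "evariance \<nu> f \<le> (SUP x. 4 * max_variance m x / ennreal \<kappa>) * (\<integral>\<^sup>+x. ennreal ((F x)\<^sup>2) \<partial>\<nu>)"
    using *(1) by (simp add: evariance_\<nu>[OF tf])
  show "evariance \<nu> f \<le> (\<integral>\<^sup>+x. local_weight m \<kappa> x * ennreal ((F x)\<^sup>2) \<partial>\<nu>)" if "reversible m \<nu>"
    using *(2)[OF _ _ that] by (simp add: evariance_\<nu>[OF tf] local_weight_eq)
qed

lemma logarithmic_sobolev:
  assumes f: "gradient_bound lam f F" and F: "slowly_varying lam F" and pos: "\<And>x. 0 < f x"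
  shows "eentropy \<nu> f
      \<le> enn2ereal ((SUP x. 4 * max_variance m x / ennreal \<kappa>) * (\<integral>\<^sup>+x. ennreal ((F x)\<^sup>2 / f x) \<partial>\<nu>))"
    and "reversible m \<nu> \<Longrightarrow> eentropy \<nu> f
      \<le> enn2ereal (\<integral>\<^sup>+x. local_weight m \<kappa> x * ennreal ((F x)\<^sup>2 / f x) \<partial>\<nu>)"
proof -
  let ?\<Phi> = "\<lambda>u::real. u * ln u"
  have tf: "tame f" using gradient_bound_tame[OF f F] lam by simp
  have ent: "eentropy \<nu> f \<le> enn2ereal R"
    if "ennreal ((\<integral>x. ?\<Phi> (f x) \<partial>\<nu>) - ?\<Phi> (\<integral>x. f x \<partial>\<nu>)) \<le> R" for R
  proof -
    have "ereal x \<le> enn2ereal (ennreal x)" for x :: real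
      by (cases "0 \<le> x") (simp_all add: enn2ereal_ennreal ennreal_neg zero_ennreal.rep_eq)
    then show ?thesis
      unfolding eentropy_\<nu>[OF tf pos] using that[unfolded less_eq_ennreal.rep_eq] order_trans by blast
  qed
  have gap: "ennreal (avg m (\<lambda>y. ?\<Phi> ((avg m ^^ t) f y)) x - ?\<Phi> ((avg m ^^ Suc t) f x))
      \<le> evariance (m x) ((avg m ^^ t) f) * ennreal (1 / (avg m ^^ Suc t) f x)" for t x
  proof -
    let ?g = "(avg m ^^ t) f" and ?a = "(avg m ^^ Suc t) f x"
    have g: "tame ?g" "0 < ?g y" for y by (auto intro: tame_iterate tf iterate_pos pos)
    have a: "0 < ?a" by (intro iterate_pos tf pos)
    have i: "integrable (m x) ?g" "integrable (m x) (\<lambda>y. (?g y)\<^sup>2)"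
      by (intro tame_integrable tame_square g)+
    have "avg m (\<lambda>y. ?\<Phi> (?g y)) x \<le> (\<integral>y. ln ?a * ?g y + ((?g y)\<^sup>2 / ?a - ?g y) \<partial>m x)"
      unfolding avg_def[of m "\<lambda>y. ?\<Phi> (?g y)" x]
    proof (rule integral_mono)
      show "integrable (m x) (\<lambda>y. ?\<Phi> (?g y))" by (intro tame_integrable tame_mult_ln g)
      show "integrable (m x) (\<lambda>y. ln ?a * ?g y + ((?g y)\<^sup>2 / ?a - ?g y))" using i by simp
      fix y
      have "ln (?g y) \<le> ln ?a + (?g y / ?a - 1)"
        using ln_le_minus_one[of "?g y / ?a"] g(2)[of y] a by (simp add: ln_div)
      from mult_left_mono[OF this less_imp_le[OF g(2)[of y]]]
      show "?\<Phi> (?g y) \<le> ln ?a * ?g y + ((?g y)\<^sup>2 / ?a - ?g y)"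
        by (simp add: algebra_simps power2_eq_square)
    qed
    also have "\<dots> = ln ?a * ?a + (avg m (\<lambda>y. (?g y)\<^sup>2) x / ?a - ?a)"
      using i by (simp add: avg_def)
    also have "\<dots> = ?\<Phi> ?a + (avg m (\<lambda>y. (?g y)\<^sup>2) x - ?a\<^sup>2) * (1 / ?a)"
      using a by (simp add: field_simps power2_eq_square)
    finally have "ennreal (avg m (\<lambda>y. ?\<Phi> (?g y)) x - ?\<Phi> ?a)
        \<le> ennreal ((avg m (\<lambda>y. (?g y)\<^sup>2) x - ?a\<^sup>2) * (1 / ?a))"
      by (intro ennreal_leI) simp
    also have "\<dots> = evariance (m x) ?g * ennreal (1 / ?a)"
      unfolding evariance_avg[OF g(1)] using a by (subst ennreal_mult'') auto
    finally show ?thesis .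
  qed
  have "isCont ?\<Phi> (\<integral>x. f x \<partial>\<nu>)" using integral_\<nu>_pos[OF tf pos] by (intro continuous_intros) auto
  note * = functional_inequality[OF f F tf pos
      tame_mult_ln[OF tame_iterate[OF tf] iterate_pos[OF tf pos]] this gap]
  show "eentropy \<nu> f
      \<le> enn2ereal ((SUP x. 4 * max_variance m x / ennreal \<kappa>) * (\<integral>\<^sup>+x. ennreal ((F x)\<^sup>2 / f x) \<partial>\<nu>))"
    by (rule ent[OF *(1)])
  show "eentropy \<nu> f
      \<le> enn2ereal (\<integral>\<^sup>+x. local_weight m \<kappa> x * ennreal ((F x)\<^sup>2 / f x) \<partial>\<nu>)" if "reversible m \<nu>"
    unfolding local_weight_eq by (rule ent[OF *(2)[OF that]])
qed

end

lemma eentropy_const: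
  assumes "prob_space \<nu>"
  shows "eentropy \<nu> (\<lambda>_. c) = 0"
proof -
  interpret prob_space \<nu> by fact
  show ?thesis
    by (cases "0 \<le> c * ln c") (simp_all add: eentropy_def prob_space emeasure_space_1 enn2ereal_ennreal max_def zero_ennreal.rep_eq)
qed

lemma dist_supp_le_granularity:
  assumes "granularity m < \<infinity>" "y \<in> supp (m x)" "z \<in> supp (m x)"
  shows "dist y z \<le> 2 * enn2real (granularity m)"
proof -
  have "ennreal (dist y z / 2) = ennreal (dist y z) / 2"
    using divide_ennreal[of "dist y z" 2] by simp
  also have "\<dots> \<le> ediameter (supp (m x)) / 2"
    unfolding ediameter_def using assms(2,3)
    by (intro divide_right_mono_ennreal SUP_upper2[of "(y, z)"]) auto
  also have "\<dots> \<le> granularity m" unfolding granularity_def by (rule SUP_upper) simp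
  also have "\<dots> = ennreal (enn2real (granularity m))" using assms(1) by simp
  finally show ?thesis by (simp add: ennreal_le_iff)
qed

lemma optimal_coupling_integral:
  assumes "optimal_coupling \<mu>\<^sub>1 \<mu>\<^sub>2 \<xi>"
  shows "(\<integral>p. dist (fst p) (snd p) \<partial>\<xi>) = enn2real (transport_dist \<mu>\<^sub>1 \<mu>\<^sub>2)"
proof -
  have sets: "sets \<xi> = sets borel" using assms by (simp add: optimal_coupling_def coupling_def)
  have "(\<lambda>p. dist (fst p) (snd p)) \<in> borel_measurable \<xi>"
    unfolding measurable_cong_sets[OF sets refl]
    by (intro borel_measurable_continuous_onI continuous_intros)
  then have "(\<integral>p. dist (fst p) (snd p) \<partial>\<xi>) = enn2real (\<integral>\<^sup>+p. ennreal (dist (fst p) (snd p)) \<partial>\<xi>)"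
    by (intro integral_eq_nn_integral) auto
  then show ?thesis using assms by (simp add: optimal_coupling_def case_prod_unfold)
qed

lemma curvature_minus_le:
  assumes opt: "optimal_coupling (m x) (m y) (\<xi> x y)" and xy: "x \<noteq> y"
    and pos: "0 < curvature m x y" and fin: "unstability m \<xi> < \<infinity>"
  shows "(\<integral>p. max 0 (dist (fst p) (snd p) - dist x y) \<partial>\<xi> x y)
    \<le> enn2real (unstability m \<xi>) * (dist x y - (\<integral>p. dist (fst p) (snd p) \<partial>\<xi> x y))"
proof -
  let ?U = "enn2real (unstability m \<xi>)" and ?k = "curvature m x y" and ?d = "dist x y"
  let ?I = "\<integral>\<^sup>+p. ennreal (max 0 (dist (fst p) (snd p) - ?d)) \<partial>\<xi> x y"
  have sets: "sets (\<xi> x y) = sets borel" using opt by (simp add: optimal_coupling_def coupling_def)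
  have meas: "(\<lambda>p. max 0 (dist (fst p) (snd p) - ?d)) \<in> borel_measurable (\<xi> x y)"
    unfolding measurable_cong_sets[OF sets refl]
    by (intro borel_measurable_continuous_onI continuous_intros)
  have d: "0 < ?d" using xy by simp
  have "curvature_minus \<xi> x y / ennreal ?k \<le> unstability m \<xi>"
    unfolding unstability_def using xy by (intro SUP_upper2[of "(x, y)"]) auto
  also have "\<dots> = ennreal ?U" using fin by simp
  finally have le: "?I / ennreal ?d / ennreal ?k \<le> ennreal ?U"
    by (simp add: curvature_minus_def case_prod_unfold)
  have "?I < \<infinity>"
  proof (rule ccontr)
    assume "\<not> ?I < \<infinity>"
    then have "?I = \<infinity>" unfolding infinity_ennreal_def less_top[symmetric] by (rule notnotD)
    then have "?I / ennreal ?d / ennreal ?k = \<infinity>" using d pos by (simp add: ennreal_top_divide)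
    then show False using le by (simp add: top_unique)
  qed
  then obtain i where i: "?I = ennreal i" "0 \<le> i" by (cases ?I) auto
  have "i / ?d / ?k \<le> ?U"
    using le i d pos by (simp add: divide_ennreal ennreal_le_iff)
  then have "i \<le> ?U * (?k * ?d)" using d pos by (simp add: field_simps)
  also have "?k * ?d = ?d - (\<integral>p. dist (fst p) (snd p) \<partial>\<xi> x y)"
    using d unfolding optimal_coupling_integral[OF opt] by (simp add: curvature_def field_simps)
  finally have "i \<le> ?U * (?d - (\<integral>p. dist (fst p) (snd p) \<partial>\<xi> x y))" .
  moreover have "(\<integral>p. max 0 (dist (fst p) (snd p) - ?d) \<partial>\<xi> x y) = i"
    using i by (subst integral_eq_nn_integral[OF meas]) auto
  ultimately show ?thesis by simp
qed

theorem theorem40: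
  fixes m :: "'a::polish_space \<Rightarrow> 'a measure"
    and \<nu> :: "'a measure"
    and \<xi> :: "'a \<Rightarrow> 'a \<Rightarrow> ('a \<times> 'a) measure"
    and \<kappa> lam :: real
    and f :: "'a \<Rightarrow> real"
  assumes "random_walk m"
    and "0 < \<kappa>"
    and "curvature_ge m \<kappa>"
    and "invariant_distribution m \<nu>"
    and "\<forall>x y. x \<noteq> y \<longrightarrow> optimal_coupling (m x) (m y) (\<xi> x y)"
    and "0 < lam"
    and "ennreal lam \<le> 1 / (24 * granularity m * (1 + unstability m \<xi>))"
    and "\<forall>x. range_gradient lam f x < \<infinity>"
  shows "evariance \<nu> f
           \<le> (SUP x. 4 * (spread m x)\<^sup>2 / (ennreal \<kappa> * local_dim m x))
               * (\<integral>\<^sup>+ x. (range_gradient lam f x)\<^sup>2 \<partial>\<nu>)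
       \<and> ((\<forall>x. 0 < f x) \<longrightarrow>
           eentropy \<nu> f
             \<le> enn2ereal ((SUP x. 4 * (spread m x)\<^sup>2 / (ennreal \<kappa> * local_dim m x))
                 * (\<integral>\<^sup>+ x. (range_gradient lam f x)\<^sup>2 / ennreal (f x) \<partial>\<nu>)))
       \<and> (reversible m \<nu> \<longrightarrow>
           evariance \<nu> f \<le> (\<integral>\<^sup>+ x. local_weight m \<kappa> x * (range_gradient lam f x)\<^sup>2 \<partial>\<nu>)
           \<and> ((\<forall>x. 0 < f x) \<longrightarrow>
               eentropy \<nu> f
                 \<le> enn2ereal (\<integral>\<^sup>+ x. local_weight m \<kappa> x
                     * ((range_gradient lam f x)\<^sup>2 / ennreal (f x)) \<partial>\<nu>)))"
proof (cases "\<exists>x y :: 'a. x \<noteq> y")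
  case False
  have \<nu>: "prob_space \<nu>" using assms(4) by (simp add: invariant_distribution_def)
  from False have const: "f = (\<lambda>_. f undefined)" by metis
  have "evariance \<nu> f = 0"
    by (subst const) (simp add: evariance_def prob_space.prob_space[OF \<nu>])
  moreover have "eentropy \<nu> f = 0" by (subst const) (rule eentropy_const[OF \<nu>])
  ultimately show ?thesis by (simp add: enn2ereal_nonneg)
next
  case True
  define \<sigma> where "\<sigma> = enn2real (granularity m)"
  define U where "U = (if \<sigma> = 0 then 0 else enn2real (unstability m \<xi>))"
  define F where "F x = enn2real (range_gradient lam f x)" for x
  have opt: "optimal_coupling (m x) (m y) (\<xi> x y)" if "x \<noteq> y" for x y using assms(5) that by blast
  have curv: "\<kappa> \<le> curvature m x y" if "x \<noteq> y" for x y using assms(3) that by (simp add: curvature_ge_def)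
  have \<kappa>1: "\<kappa> \<le> 1"
  proof -
    obtain x y :: 'a where "x \<noteq> y" using True by blast
    have "0 \<le> enn2real (transport_dist (m x) (m y)) / dist x y" by (intro divide_nonneg_nonneg) auto
    then show ?thesis using curv[OF \<open>x \<noteq> y\<close>] unfolding curvature_def by linarith
  qed
  have pos: "0 < 1 / (24 * granularity m * (1 + unstability m \<xi>))"
    using assms(6,7) by (metis ennreal_less_zero_iff order_less_le_trans)
  have fin: "granularity m < \<infinity>"
  proof (rule ccontr)
    assume "\<not> granularity m < \<infinity>"
    then have "granularity m = \<infinity>" unfolding infinity_ennreal_def less_top[symmetric] by (rule notnotD)
    then show False using pos by (simp add: ennreal_mult_top ennreal_top_mult)
  qed
  then have g\<sigma>: "granularity m = ennreal \<sigma>" "0 \<le> \<sigma>" by (simp_all add: \<sigma>_def)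
  have Ufin: "unstability m \<xi> < \<infinity>" if "0 < \<sigma>"
  proof (rule ccontr)
    assume "\<not> unstability m \<xi> < \<infinity>"
    then have "unstability m \<xi> = \<infinity>" unfolding infinity_ennreal_def less_top[symmetric] by (rule notnotD)
    then show False using pos that g\<sigma> by (simp add: ennreal_mult_top flip: ennreal_mult ennreal_numeral)
  qed
  interpret invariant_walk m \<sigma> \<xi> \<kappa> U lam \<nu>
  proof unfold_locales
    show "m \<in> borel \<rightarrow>\<^sub>M prob_algebra borel" using assms(1) by (simp add: random_walk_def)
    show "dist y z \<le> 2 * \<sigma>" if "y \<in> supp (m x)" "z \<in> supp (m x)" for x y z
      using dist_supp_le_granularity[OF fin that] by (simp add: \<sigma>_def)
    show "coupling (m x) (m y) (\<xi> x y)" if "x \<noteq> y" for x y using opt[OF that] by (simp add: optimal_coupling_def)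
    show "0 \<le> U" by (simp add: U_def)
    show "lam * \<sigma> * (1 + U) \<le> 1 / 24"
    proof (cases "\<sigma> = 0")
      case False
      then have "0 < \<sigma>" using g\<sigma>(2) by simp
      then have "unstability m \<xi> = ennreal U" using Ufin by (simp add: U_def)
      then have "24 * granularity m * (1 + unstability m \<xi>) = ennreal (24 * \<sigma> * (1 + U))"
        using g\<sigma> by (simp add: U_def ennreal_mult)
      then have "1 / (24 * granularity m * (1 + unstability m \<xi>)) = ennreal (1 / (24 * \<sigma> * (1 + U)))"
        using \<open>0 < \<sigma>\<close> divide_ennreal[of 1 "24 * \<sigma> * (1 + U)"] by (simp add: U_def add_pos_nonneg)
      then have "lam \<le> 1 / (24 * \<sigma> * (1 + U))"
        using assms(7) \<open>0 < \<sigma>\<close> by (simp add: ennreal_le_iff U_def)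
      moreover have "0 < 24 * \<sigma> * (1 + U)" using \<open>0 < \<sigma>\<close> by (simp add: U_def add_pos_nonneg)
      ultimately show ?thesis by (simp add: field_simps)
    qed simp
    show "(\<integral>p. dist (fst p) (snd p) \<partial>\<xi> x y) \<le> (1 - \<kappa>) * dist x y" if "x \<noteq> y" for x y
      using curv[OF that] that unfolding optimal_coupling_integral[OF opt[OF that]]
      by (simp add: curvature_def field_simps)
    show "(\<integral>p. max 0 (dist (fst p) (snd p) - dist x y) \<partial>\<xi> x y)
        \<le> U * (dist x y - (\<integral>p. dist (fst p) (snd p) \<partial>\<xi> x y))" if "x \<noteq> y" "0 < \<sigma>" for x y
      using curvature_minus_le[OF opt[OF that(1)] that(1) _ Ufin[OF that(2)]] curv[OF that(1)] assms(2) that(2)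
      by (simp add: U_def)
  qed (use assms \<kappa>1 in auto)
  have grad: "range_gradient lam f x = ennreal (F x)" "0 \<le> F x" for x
    using assms(8) by (simp_all add: F_def)
  have sv: "slowly_varying lam F" and gb: "gradient_bound lam f F"
    using range_gradient_slowly_varying[OF assms(6)] range_gradient_gradient_bound assms(8)
    by (auto simp: F_def[abs_def])
  have sq: "(range_gradient lam f x)\<^sup>2 = ennreal ((F x)\<^sup>2)" for x
    using grad by (simp add: ennreal_power)
  have quot: "(range_gradient lam f x)\<^sup>2 / ennreal (f x) = ennreal ((F x)\<^sup>2 / f x)" if "\<forall>x. 0 < f x" for x
    unfolding sq using that by (intro divide_ennreal) auto
  show ?thesis
    unfolding spread_local_dim(2)[OF assms(2)] sq
    using poincare[OF gb sv] logarithmic_sobolev[OF gb sv] quot[unfolded sq] by auto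
qed

end
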